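(* Let $R(f)=\frac12\|f\|^2$. There is a constant $\beta_{dual}>0$, depending only on $C^R$, $c_1$, $\eta$, $N_p$ (not on $d$, $\delta$, $\alpha_{acc}$, $\alpha$, $f^0$, $B_p$ or $\mathbb{P}^{xy}$), such that the following holds. Let $f^0\in\mathbb{R}^d\setminus\{0\}$, $\alpha_{acc}\in(0,1]$, $\alpha\in(0,1]$, $\delta\in(0,1/2)$, and set $\rho=\alpha_{acc}/\|f^0\|^2$. Let $D_p$ consist of $B_p$ i.i.d. samples from $\mathbb{P}^{xy}$. Let $\hat\alpha=\alpha-2\ln\big(1+\frac{c_1C^R}{B_p(\rho+2\eta N_p)}\big)$, let $\epsilon$ be drawn independently of $D_p$ with density proportional to $e^{-(\hat\alpha/2)\|\epsilon\|}$, and let $$f^*_p=\arg\min_f\Big(Z_p(f\mid D_p)+\frac{C^R}{B_p}\epsilon^Tf\Big).$$ If $$B_p>\beta_{dual}\max\Big(\frac{\|f^0\|\,d\ln(d/\delta)}{\alpha_{acc}\alpha},\ \frac{C^Rc_1\|f^0\|^2}{\alpha_{acc}\alpha},\ \frac{C^R\|f^0\|^2\ln(1/\delta)}{\alpha_{acc}^2}\Big),$$ then $\hat\alpha>0$ and $\mathbb{P}\big(\hat C(f^*_p)\le\hat C(f^0)+\alpha_{acc}\big)\ge1-2\delta$, the probability being over $D_p$ and $\epsilon$.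
   Context: $\mathbb{P}^{xy}$ is a probability distribution on $\{x\in\mathbb{R}^d:\|x\|\le1\}\times\{-1,1\}$. The loss $\mathcal{L}:\mathbb{R}\to\mathbb{R}$ is strictly convex and twice continuously differentiable with $|\mathcal{L}'|\le1$ and $|\mathcal{L}''|\le c_1$. $C^R>0$, $\eta>0$, $N_p\ge1$ an integer. $Z_p(f\mid D_p)=\frac{C^R}{B_p}\sum_{j=1}^{B_p}\mathcal{L}(y_jf^Tx_j)+\rho R(f)$ for $D_p=((x_j,y_j))_{j=1}^{B_p}$. The expected loss is $\hat C(f)=C^R\,\mathbb{E}_{(x,y)\sim\mathbb{P}^{xy}}[\mathcal{L}(yf^Tx)]$. *)

theory Defs
  imports "HOL-Probability.Probability"
begin

text \<open>Vectors of R^d are represented as extensional functions in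
  the extensional functions on {..<d} (the space of the product Lebesgue measure).\<close>

definition Rd :: "nat \<Rightarrow> (nat \<Rightarrow> real) set" where
  "Rd d = {..<d} \<rightarrow>\<^sub>E (UNIV :: real set)"

definition lebd :: "nat \<Rightarrow> (nat \<Rightarrow> real) measure" where
  "lebd d = PiM {..<d} (\<lambda>_. lborel)"

definition vinner :: "nat \<Rightarrow> (nat \<Rightarrow> real) \<Rightarrow> (nat \<Rightarrow> real) \<Rightarrow> real" where
  "vinner d f x = (\<Sum>i<d. f i * x i)"

definition vnorm :: "nat \<Rightarrow> (nat \<Rightarrow> real) \<Rightarrow> real" where
  "vnorm d f = sqrt (\<Sum>i<d. (f i)\<^sup>2)"

definition strictly_convex :: "(real \<Rightarrow> real) \<Rightarrow> bool" where
  "strictly_convex L \<longleftrightarrow> (\<forall>x y t. x \<noteq> y \<and> 0 < t \<and> t < 1 \<longrightarrow>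
      L (t * x + (1 - t) * y) < t * L x + (1 - t) * L y)"

definition Rreg :: "nat \<Rightarrow> (nat \<Rightarrow> real) \<Rightarrow> real" where
  "Rreg d f = (1/2) * (vnorm d f)\<^sup>2"

definition Zp :: "real \<Rightarrow> (real \<Rightarrow> real) \<Rightarrow> real \<Rightarrow> nat \<Rightarrow> nat
    \<Rightarrow> (nat \<Rightarrow> (nat \<Rightarrow> real) \<times> real) \<Rightarrow> (nat \<Rightarrow> real) \<Rightarrow> real" where
  "Zp CR L \<rho> d B D f =
     CR / real B * (\<Sum>j<B. L (snd (D j) * vinner d f (fst (D j)))) + \<rho> * Rreg d f"

definition fstar :: "real \<Rightarrow> (real \<Rightarrow> real) \<Rightarrow> real \<Rightarrow> nat \<Rightarrow> nat
    \<Rightarrow> (nat \<Rightarrow> (nat \<Rightarrow> real) \<times> real) \<Rightarrow> (nat \<Rightarrow> real) \<Rightarrow> (nat \<Rightarrow> real)" where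
  "fstar CR L \<rho> d B D e =
     (THE f. f \<in> Rd d \<and> (\<forall>g \<in> Rd d.
        Zp CR L \<rho> d B D f + CR / real B * vinner d e f
          \<le> Zp CR L \<rho> d B D g + CR / real B * vinner d e g))"

definition Chat :: "real \<Rightarrow> (real \<Rightarrow> real) \<Rightarrow> ((nat \<Rightarrow> real) \<times> real) measure
    \<Rightarrow> nat \<Rightarrow> (nat \<Rightarrow> real) \<Rightarrow> real" where
  "Chat CR L P d f = CR * (\<integral>z. L (snd z * vinner d f (fst z)) \<partial>P)"

definition noise :: "nat \<Rightarrow> real \<Rightarrow> (nat \<Rightarrow> real) measure" where
  "noise d a = density (lebd d)
     (\<lambda>e. ennreal (exp (- (a/2) * vnorm d e)
                     / (\<integral>e'. exp (- (a/2) * vnorm d e') \<partial>lebd d)))"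

definition alpha_hat :: "real \<Rightarrow> real \<Rightarrow> real \<Rightarrow> nat \<Rightarrow> real \<Rightarrow> real \<Rightarrow> nat \<Rightarrow> real" where
  "alpha_hat \<alpha> c1 CR B \<rho> \<eta> Np =
     \<alpha> - 2 * ln (1 + c1 * CR / (real B * (\<rho> + 2 * \<eta> * real Np)))"

end

theory Submission
  imports Defs
begin

text \<open>Let \<open>J = Chat + \<rho>/2 |f|\<^sup>2\<close> have minimizer \<open>h\<close>. Strong convexity of \<open>J\<close> localizes \<open>f\<^sup>*\<close>: if the
  empirical excess risk over \<open>h\<close> deviates from the true one by at most \<open>r \<gamma>\<close> on the ball of radius
  \<open>r \<approx> \<gamma>/\<rho>\<close> about \<open>h\<close> (where \<open>\<gamma>\<close> also absorbs the noise), then \<open>f\<^sup>*\<close> lies in that ball and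
  \<open>J f\<^sup>* - J h\<close> is of order \<open>\<gamma>\<^sup>2/\<rho>\<close>. As \<open>\<rho> = \<alpha>\<^sub>a\<^sub>c\<^sub>c/|f0|\<^sup>2\<close>, the sample size makes this at most
  \<open>\<alpha>\<^sub>a\<^sub>c\<^sub>c/2\<close>, and comparing \<open>J h\<close> with \<open>J f0\<close> costs another \<open>\<alpha>\<^sub>a\<^sub>c\<^sub>c/2\<close>.

  The dimension-free deviation bound comes from the exponential moment of the supremum over a
  finite net. Samples are replaced one at a time by signed linear terms (Jensen and contraction),
  and the accumulated vector \<open>v\<close> is controlled by
  \<open>cosh |v + x| + cosh |v - x| \<le> 2 cosh |v| cosh |x|\<close>, valid in Euclidean space because
  \<open>u \<mapsto> cosh \<surd>u\<close> is convex.\<close>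

section \<open>Strongly convex functions of finitely many coordinates\<close>

text \<open>Vectors are functions on all naturals of which only the coordinates below
  \<open>d\<close> carry meaning. Sequential continuity in these coordinates stands for continuity
  on R^d, and it also forces \<open>G\<close> to ignore all other coordinates.\<close>

definition coord_continuous :: "nat \<Rightarrow> ((nat \<Rightarrow> real) \<Rightarrow> real) \<Rightarrow> bool" where
  "coord_continuous d G \<longleftrightarrow>
     (\<forall>X f. (\<forall>i<d. (\<lambda>n. X n i) \<longlonglongrightarrow> f i) \<longrightarrow> (\<lambda>n. G (X n)) \<longlonglongrightarrow> G f)"

text \<open>The modulus is normalised so that \<open>\<rho> / 2 * (vnorm d f)\<^sup>2\<close>
  satisfies the inequality with equality.\<close>

definition strongly_convex :: "nat \<Rightarrow> real \<Rightarrow> ((nat \<Rightarrow> real) \<Rightarrow> real) \<Rightarrow> bool" where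
  "strongly_convex d \<rho> G \<longleftrightarrow> (\<forall>f g t. 0 \<le> t \<and> t \<le> 1 \<longrightarrow>
     G (\<lambda>i. t * f i + (1 - t) * g i)
       \<le> t * G f + (1 - t) * G g - \<rho> / 2 * t * (1 - t) * (vnorm d (\<lambda>i. f i - g i))\<^sup>2)"

lemma vnorm_eq_L2_set: "vnorm d f = L2_set f {..<d}"
  by (simp add: vnorm_def L2_set_def)

lemma vnorm_nonneg [simp]: "0 \<le> vnorm d f"
  by (simp add: vnorm_def sum_nonneg)

lemma vnorm_sq: "(vnorm d f)\<^sup>2 = (\<Sum>i<d. (f i)\<^sup>2)"
  by (simp add: vnorm_def sum_nonneg)

lemma vinner_le: "\<bar>vinner d f g\<bar> \<le> vnorm d f * vnorm d g"
proof -
  have "\<bar>vinner d f g\<bar> \<le> (\<Sum>i<d. \<bar>f i\<bar> * \<bar>g i\<bar>)"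
    unfolding vinner_def by (rule order_trans[OF sum_abs]) (simp add: abs_mult)
  also have "\<dots> \<le> vnorm d f * vnorm d g"
    unfolding vnorm_eq_L2_set by (rule L2_set_mult_ineq)
  finally show ?thesis .
qed

lemma abs_coord_le_vnorm: "i < d \<Longrightarrow> \<bar>f i\<bar> \<le> vnorm d f"
  using member_le_L2_set[of "{..<d}" i "\<lambda>i. \<bar>f i\<bar>"]
  by (simp add: vnorm_eq_L2_set L2_set_def)

lemma vnorm_scale: "vnorm d (\<lambda>i. c * f i) = \<bar>c\<bar> * vnorm d f"
  by (simp add: vnorm_def power_mult_distrib sum_distrib_left[symmetric] real_sqrt_mult)

lemma vinner_add_left: "vinner d (\<lambda>i. f i + g i) x = vinner d f x + vinner d g x"
  by (simp add: vinner_def sum.distrib algebra_simps)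

lemma vinner_diff_left: "vinner d (\<lambda>i. f i - g i) x = vinner d f x - vinner d g x"
  by (simp add: vinner_def sum_subtractf algebra_simps)

lemma vinner_scale_left: "vinner d (\<lambda>i. c * f i) x = c * vinner d f x"
  by (simp add: vinner_def sum_distrib_left algebra_simps)

lemma vinner_commute: "vinner d f g = vinner d g f"
  by (simp add: vinner_def mult.commute)

lemma measurable_lebd_coord [measurable]: "i < d \<Longrightarrow> (\<lambda>x. x i) \<in> borel_measurable (lebd d)"
  unfolding lebd_def by simp

lemma measurable_vnorm [measurable]: "vnorm d \<in> borel_measurable (lebd d)"
  unfolding vnorm_def by measurable

lemma coord_continuousD:
  "coord_continuous d G \<Longrightarrow> (\<And>i. i < d \<Longrightarrow> (\<lambda>n. X n i) \<longlonglongrightarrow> f i) \<Longrightarrow> (\<lambda>n. G (X n)) \<longlonglongrightarrow> G f"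
  by (auto simp: coord_continuous_def)

text \<open>The constant sequence \<open>f\<close> converges to \<open>g\<close> in the coordinates
  that count, so the constant value \<open>G f\<close> must be the limit \<open>G g\<close>.\<close>

lemma coord_continuous_cong:
  assumes "coord_continuous d G" "\<And>i. i < d \<Longrightarrow> f i = g i"
  shows "G f = G g"
proof -
  have "(\<lambda>n::nat. G f) \<longlonglongrightarrow> G g"
    using coord_continuousD[OF assms(1), of "\<lambda>_. f" g] assms(2) by simp
  then show ?thesis by (simp add: LIMSEQ_const_iff)
qed

lemma coord_continuous_vnorm: "coord_continuous d (vnorm d)"
  unfolding coord_continuous_def vnorm_def by (auto intro!: tendsto_intros)

lemma coord_continuous_vinner: "coord_continuous d (\<lambda>f. vinner d f x)"
  unfolding coord_continuous_def vinner_def by (auto intro!: tendsto_intros)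

text \<open>The midpoint of \<open>f\<close> and \<open>h\<close> has value at least
  \<open>G h\<close>. The choice \<open>t = 1/2\<close> yields the factor 1/4, half of the sharp
  constant, which suffices for the localization.\<close>

lemma strongly_convex_min_growth:
  assumes sc: "strongly_convex d \<rho> G" and min: "\<And>g. G h \<le> G g"
  shows "\<rho> / 4 * (vnorm d (\<lambda>i. f i - h i))\<^sup>2 \<le> G f - G h"
proof -
  have "G (\<lambda>i. 1/2 * f i + (1 - 1/2) * h i)
       \<le> 1/2 * G f + (1 - 1/2) * G h - \<rho> / 2 * (1/2) * (1 - 1/2) * (vnorm d (\<lambda>i. f i - h i))\<^sup>2"
    using sc unfolding strongly_convex_def by (elim allE[of _ f] allE[of _ h] allE[of _ "1/2"]) auto
  with min[of "\<lambda>i. 1/2 * f i + (1 - 1/2) * h i"] show ?thesis by (simp add: field_simps)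
qed

text \<open>Strong convexity makes a minimizing sequence Cauchy in each coordinate, so completeness
  of the reals takes the place of compactness; continuity carries the infimum to the limit.\<close>

lemma strongly_convex_min_exists:
  assumes sc: "strongly_convex d \<rho> G" and \<rho>: "\<rho> > 0" and cont: "coord_continuous d G"
    and bdd: "\<And>f. m0 \<le> G f"
  shows "\<exists>h. \<forall>g. G h \<le> G g"
proof -
  define m where "m = Inf (range G)"
  have bb: "bdd_below (range G)" using bdd by (auto simp: bdd_below_def)
  have m_le: "m \<le> G f" for f unfolding m_def using bb by (auto intro: cInf_lower)
  have "\<exists>f. G f < m + inverse (real (Suc n))" for n
    using cInf_lessD[of "range G" "m + inverse (real (Suc n))"] m_def by fastforce
  then obtain X where X: "\<And>n. G (X n) < m + inverse (real (Suc n))" by metis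
  \<comment> \<open>Two points within \<open>e\<close> of the infimum have a midpoint not below it,
    so the quadratic gain, \<open>\<rho> / 8\<close> times their squared distance, is at most
    \<open>e\<close>.\<close>
  have close: "(vnorm d (\<lambda>i. f i - g i))\<^sup>2 \<le> 8 / \<rho> * e"
    if "G f \<le> m + e" "G g \<le> m + e" for f g e
  proof -
    have "G (\<lambda>i. (1/2) * f i + (1 - 1/2) * g i)
       \<le> (1/2) * G f + (1 - 1/2) * G g - \<rho> / 2 * (1/2) * (1 - 1/2) * (vnorm d (\<lambda>i. f i - g i))\<^sup>2"
      using sc unfolding strongly_convex_def by (elim allE[of _ f] allE[of _ g] allE[of _ "1/2"]) auto
    with that m_le[of "\<lambda>i. (1/2) * f i + (1 - 1/2) * g i"] \<rho> show ?thesis by (simp add: field_simps)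
  qed
  have "convergent (\<lambda>n. X n i)" if i: "i < d" for i
  proof -
    have "Cauchy (\<lambda>n. X n i)"
    proof (rule metric_CauchyI)
      fix e :: real assume e: "e > 0"
      obtain N where N: "inverse (real (Suc N)) < e\<^sup>2 * \<rho> / 8"
        using reals_Archimedean[of "e\<^sup>2 * \<rho> / 8"] e \<rho> by auto
      have "dist (X k i) (X n i) < e" if "k \<ge> N" "n \<ge> N" for k n
      proof -
        have *: "G (X j) \<le> m + inverse (real (Suc N))" if "j \<ge> N" for j
          using X[of j] that le_imp_inverse_le[of "real (Suc N)" "real (Suc j)"] by linarith
        have "(X k i - X n i)\<^sup>2 \<le> (vnorm d (\<lambda>i. X k i - X n i))\<^sup>2"
          using abs_coord_le_vnorm[OF i, of "\<lambda>i. X k i - X n i"] by (metis abs_ge_zero power2_abs power_mono)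
        also have "\<dots> \<le> 8 / \<rho> * inverse (real (Suc N))"
          using close * that by blast
        also have "\<dots> < 8 / \<rho> * (e\<^sup>2 * \<rho> / 8)" using N \<rho> by (intro mult_strict_left_mono) auto
        also have "\<dots> = e\<^sup>2" using \<rho> by simp
        finally have "\<bar>X k i - X n i\<bar> < e" using e abs_le_square_iff[of e "X k i - X n i"] by (simp add: not_le[symmetric])
        then show ?thesis by (simp add: dist_real_def)
      qed
      then show "\<exists>M. \<forall>m\<ge>M. \<forall>n\<ge>M. dist (X m i) (X n i) < e" by blast
    qed
    then show ?thesis by (simp add: real_Cauchy_convergent)
  qed
  then have "(\<lambda>n. G (X n)) \<longlonglongrightarrow> G (\<lambda>i. lim (\<lambda>n. X n i))"
    by (intro coord_continuousD[OF cont]) (simp add: convergent_LIMSEQ_iff)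
  moreover have "(\<lambda>n. m + inverse (real (Suc n))) \<longlonglongrightarrow> m + 0"
    by (intro tendsto_intros LIMSEQ_inverse_real_of_nat)
  ultimately have "G (\<lambda>i. lim (\<lambda>n. X n i)) \<le> m + 0"
    using X by (intro LIMSEQ_le[of "\<lambda>n. G (X n)"]) (auto intro: less_imp_le)
  then show ?thesis using m_le by (metis add.right_neutral order_trans)
qed

section \<open>Measurability of sublevel sets at a minimizer\<close>

lemma rational_approx:
  fixes f :: "nat \<Rightarrow> real"
  obtains q where "\<And>n. q n \<in> {..<d} \<rightarrow>\<^sub>E \<rat>" "\<And>i. i < d \<Longrightarrow> (\<lambda>n. q n i) \<longlonglongrightarrow> f i"
proof -
  have "\<exists>x\<in>\<rat>. f i < x \<and> x < f i + inverse (real (Suc n))" for n i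
    using Rats_dense_in_real[of "f i" "f i + inverse (real (Suc n))"] by simp
  then have "\<forall>n i. \<exists>x. x\<in>\<rat> \<and> f i < x \<and> x < f i + inverse (real (Suc n))" by blast
  then obtain x where "\<forall>n i. x n i\<in>\<rat> \<and> f i < x n i \<and> x n i < f i + inverse (real (Suc n))"
    unfolding choice_iff by blast
  then have x: "\<And>n i. x n i \<in> \<rat>" "\<And>n i. f i < x n i" "\<And>n i. x n i < f i + inverse (real (Suc n))"
    by auto
  define q where "q n = restrict (x n) {..<d}" for n
  have "(\<lambda>n. x n i) \<longlonglongrightarrow> f i" for i
  proof (rule tendsto_sandwich[of "\<lambda>_. f i" _ _ "\<lambda>n. f i + inverse (real (Suc n))"])
    show "(\<lambda>n. f i + inverse (real (Suc n))) \<longlonglongrightarrow> f i"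
      using tendsto_add[OF tendsto_const LIMSEQ_inverse_real_of_nat, of "f i"] by simp
  qed (auto intro!: always_eventually less_imp_le x simp del: of_nat_Suc)
  then show ?thesis using x by (intro that[of q]) (auto simp: q_def)
qed

text \<open>\<open>m w\<close> is only known as a minimizer, not as a measurable map. Its sublevel
  set is therefore rewritten with countable quantifiers: for every \<open>n\<close> some rational
  point nearly minimizes \<open>G w\<close> among rational points and nearly satisfies the bound on
  \<open>C\<close>.\<close>

lemma minimizer_sublevel_measurable:
  fixes G :: "'w \<Rightarrow> (nat \<Rightarrow> real) \<Rightarrow> real"
  assumes meas: "\<And>f. (\<lambda>w. G w f) \<in> borel_measurable M"
    and sc: "\<And>w. w \<in> space M \<Longrightarrow> strongly_convex d \<rho> (G w)" and \<rho>: "\<rho> > 0"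
    and cont: "\<And>w. w \<in> space M \<Longrightarrow> coord_continuous d (G w)"
    and min: "\<And>w g. w \<in> space M \<Longrightarrow> G w (m w) \<le> G w g"
    and C: "coord_continuous d C"
  shows "{w \<in> space M. C (m w) \<le> c} \<in> sets M"
proof -
  define Q :: "(nat \<Rightarrow> real) set" where "Q = {..<d} \<rightarrow>\<^sub>E \<rat>"
  have Qc: "countable Q" unfolding Q_def by (intro countable_PiE) (auto simp: countable_rat)
  have iff: "C (m w) \<le> c \<longleftrightarrow> (\<forall>n::nat. \<exists>q\<in>Q. C q \<le> c + inverse (real (Suc n))
      \<and> (\<forall>p\<in>Q. G w q \<le> G w p + inverse (real (Suc n))))" (is "_ \<longleftrightarrow> ?R")
    if w: "w \<in> space M" for w
  proof
    assume le: "C (m w) \<le> c"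
    show ?R
    proof
      fix n :: nat
      obtain q where q: "\<And>k. q k \<in> Q" "\<And>i. i < d \<Longrightarrow> (\<lambda>k. q k i) \<longlonglongrightarrow> m w i"
        using rational_approx[of d "m w"] unfolding Q_def by metis
      have e: "inverse (real (Suc n)) > 0" by simp
      have "eventually (\<lambda>k. C (q k) < c + inverse (real (Suc n))) sequentially"
        by (rule order_tendstoD(2)[OF coord_continuousD[OF C q(2)]]) (use le e in linarith)+
      moreover have "eventually (\<lambda>k. G w (q k) < G w (m w) + inverse (real (Suc n))) sequentially"
        by (rule order_tendstoD(2)[OF coord_continuousD[OF cont[OF w] q(2)]]) (use e in linarith)+
      ultimately have "eventually (\<lambda>k. C (q k) < c + inverse (real (Suc n)) \<and>
          G w (q k) < G w (m w) + inverse (real (Suc n))) sequentially" by (rule eventually_conj)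
      then obtain k where "C (q k) < c + inverse (real (Suc n))"
          "G w (q k) < G w (m w) + inverse (real (Suc n))"
        using eventually_happens'[OF sequentially_bot] by blast
      with q(1)[of k] min[OF w] show "\<exists>q\<in>Q. C q \<le> c + inverse (real (Suc n))
          \<and> (\<forall>p\<in>Q. G w q \<le> G w p + inverse (real (Suc n)))"
        by (intro bexI[of _ "q k"]) (auto intro: order_trans[OF less_imp_le])
    qed
  next
    assume ?R
    then obtain q where q: "\<And>n. q n \<in> Q" "\<And>n. C (q n) \<le> c + inverse (real (Suc n))"
      "\<And>n p. p \<in> Q \<Longrightarrow> G w (q n) \<le> G w p + inverse (real (Suc n))" by metis
    obtain p where p: "\<And>k. p k \<in> Q" "\<And>i. i < d \<Longrightarrow> (\<lambda>k. p k i) \<longlonglongrightarrow> m w i"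
      using rational_approx[of d "m w"] unfolding Q_def by metis
    \<comment> \<open>Near-minimality among rational points becomes near-minimality against
      \<open>m w\<close> itself by letting rational points tend to \<open>m w\<close>.\<close>
    have le: "G w (q n) \<le> G w (m w) + inverse (real (Suc n))" for n
    proof (rule LIMSEQ_le_const)
      show "(\<lambda>k. G w (p k) + inverse (real (Suc n))) \<longlonglongrightarrow> G w (m w) + inverse (real (Suc n))"
        by (intro tendsto_intros coord_continuousD[OF cont[OF w] p(2)])
    qed (use q(3) p(1) in auto)
    have "(\<lambda>n. q n i) \<longlonglongrightarrow> m w i" if i: "i < d" for i
    proof -
      \<comment> \<open>Quadratic growth turns the small excess value of \<open>q n\<close> into a
        small distance to \<open>m w\<close>.\<close>
      have bd: "\<bar>q n i - m w i\<bar> \<le> sqrt (4 / \<rho> * inverse (real (Suc n)))" for n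
      proof (rule real_le_rsqrt)
        have "(q n i - m w i)\<^sup>2 \<le> (vnorm d (\<lambda>i. q n i - m w i))\<^sup>2"
          using abs_coord_le_vnorm[OF i, of "\<lambda>i. q n i - m w i"] by (metis abs_ge_zero power2_abs power_mono)
        also have "\<dots> \<le> 4 / \<rho> * (G w (q n) - G w (m w))"
          using strongly_convex_min_growth[OF sc[OF w] min[OF w], of "q n"] \<rho> by (simp add: field_simps)
        also have "\<dots> \<le> 4 / \<rho> * inverse (real (Suc n))"
          using le[of n] \<rho> by (intro mult_left_mono) auto
        finally show "\<bar>q n i - m w i\<bar>\<^sup>2 \<le> 4 / \<rho> * inverse (real (Suc n))" by simp
      qed
      have "(\<lambda>n. sqrt (4 / \<rho> * inverse (real (Suc n)))) \<longlonglongrightarrow> sqrt (4 / \<rho> * 0)"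
        by (intro tendsto_intros LIMSEQ_inverse_real_of_nat)
      then have "(\<lambda>n. q n i - m w i) \<longlonglongrightarrow> 0"
        by (intro Lim_null_comparison[OF always_eventually, of "\<lambda>n. q n i - m w i"]) (use bd in auto)
      then show ?thesis by (simp add: LIM_zero_iff)
    qed
    then have "(\<lambda>n. C (q n)) \<longlonglongrightarrow> C (m w)" by (rule coord_continuousD[OF C])
    moreover have "(\<lambda>n. c + inverse (real (Suc n))) \<longlonglongrightarrow> c + 0"
      by (intro tendsto_intros LIMSEQ_inverse_real_of_nat)
    ultimately show "C (m w) \<le> c"
      using q(2) LIMSEQ_le[of "\<lambda>n. C (q n)" _ "\<lambda>n. c + inverse (real (Suc n))" "c + 0"] by auto
  qed
  have "{w \<in> space M. \<forall>n::nat. \<exists>q\<in>Q. C q \<le> c + inverse (real (Suc n))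
      \<and> (\<forall>p\<in>Q. G w q \<le> G w p + inverse (real (Suc n)))} \<in> sets M"
    using Qc meas by measurable
  also have "{w \<in> space M. \<forall>n::nat. \<exists>q\<in>Q. C q \<le> c + inverse (real (Suc n))
      \<and> (\<forall>p\<in>Q. G w q \<le> G w p + inverse (real (Suc n)))} = {w \<in> space M. C (m w) \<le> c}"
    using iff by auto
  finally show ?thesis .
qed

lemma vnorm_add_sq:
  "(vnorm d (\<lambda>i. f i + s * g i))\<^sup>2 = (vnorm d f)\<^sup>2 + 2 * s * vinner d f g + s\<^sup>2 * (vnorm d g)\<^sup>2"
  unfolding vnorm_sq vinner_def
  by (simp add: power2_sum sum.distrib sum_distrib_left power_mult_distrib algebra_simps)

section \<open>Exponential inequalities\<close>

text \<open>Two-point weak majorization for an increasing convex function. After ordering both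
  pairs, the nontrivial case reduces to \<open>(exp X - exp a) * (exp a - exp Y)\<close> being
  nonnegative.\<close>

lemma exp_sum_weak_majorization:
  fixes a b X Y :: real
  assumes "a + b \<le> X + Y" "a \<le> max X Y" "b \<le> max X Y"
  shows "exp a + exp b \<le> exp X + exp Y"
proof -
  have *: "exp a + exp b \<le> exp X + exp Y"
    if "a + b \<le> X + Y" "a \<le> X" "b \<le> a" "Y \<le> X" for a b X Y :: real
  proof (cases "a \<le> Y")
    case True
    then show ?thesis using that by (intro add_mono) auto
  next
    case False
    have "exp b \<le> exp (X + Y - a)" using that by simp
    also have "\<dots> = exp X * exp Y / exp a" by (simp add: exp_add exp_diff)
    finally have "exp b \<le> exp X * exp Y / exp a" .
    moreover have "0 \<le> (exp X - exp a) * (exp a - exp Y) / exp a"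
      using that False by (intro divide_nonneg_pos mult_nonneg_nonneg) auto
    moreover have "(exp X - exp a) * (exp a - exp Y) / exp a = exp X + exp Y - exp a - exp X * exp Y / exp a"
      by (simp add: field_simps)
    ultimately show ?thesis by linarith
  qed
  show ?thesis
  proof (cases "b \<le> a"; cases "Y \<le> X")
  qed (use *[of a b X Y] *[of a b Y X] *[of b a X Y] *[of b a Y X] assms in \<open>auto simp: add.commute\<close>)
qed

text \<open>One step of the contraction principle for a random sign. The maximizers \<open>f\<close>
  and \<open>g\<close> of the two left-hand maxima are tested in both right-hand maxima:
  \<open>contr\<close> bounds the sum of the two exponents, \<open>bound\<close> each of them
  separately, and weak majorization concludes.\<close>

lemma exp_Max_contraction:
  fixes c u t :: "'f \<Rightarrow> real"
  assumes F: "finite F" "F \<noteq> {}" and l: "0 \<le> l"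
    and contr: "\<And>f g. f \<in> F \<Longrightarrow> g \<in> F \<Longrightarrow> \<bar>u f - u g\<bar> \<le> \<bar>t f - t g\<bar>"
    and bound: "\<And>f. f \<in> F \<Longrightarrow> \<bar>u f\<bar> \<le> \<bar>t f\<bar>"
  shows "exp (l * (MAX f\<in>F. c f + u f)) + exp (l * (MAX f\<in>F. c f - u f))
       \<le> exp (l * (MAX f\<in>F. c f + t f)) + exp (l * (MAX f\<in>F. c f - t f))"
proof -
  have in_Max: "\<exists>f\<in>F. (MAX f\<in>F. w f) = w f" for w :: "'f \<Rightarrow> real"
  proof -
    have "(MAX f\<in>F. w f) \<in> w ` F" using F by (intro Max_in) auto
    then show ?thesis by auto
  qed
  have ge: "w f \<le> (MAX f\<in>F. w f)" if "f \<in> F" for w :: "'f \<Rightarrow> real" and f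
    using F that by (intro Max_ge) auto
  obtain f where f: "f \<in> F" "(MAX f\<in>F. c f + u f) = c f + u f" using in_Max[of "\<lambda>f. c f + u f"] by auto
  obtain g where g: "g \<in> F" "(MAX f\<in>F. c f - u f) = c g - u g" using in_Max[of "\<lambda>f. c f - u f"] by auto
  define X where "X = (MAX f\<in>F. c f + t f)"
  define Y where "Y = (MAX f\<in>F. c f - t f)"
  have X: "c f + t f \<le> X" "c g + t g \<le> X" and Y: "c f - t f \<le> Y" "c g - t g \<le> Y"
    unfolding X_def Y_def using ge[OF f(1), of "\<lambda>f. c f + t f"] ge[OF g(1), of "\<lambda>f. c f + t f"]
      ge[OF f(1), of "\<lambda>f. c f - t f"] ge[OF g(1), of "\<lambda>f. c f - t f"] by auto
  \<comment> \<open>Whichever sign \<open>t f - t g\<close> has, assigning one of \<open>f\<close>,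
    \<open>g\<close> to \<open>X\<close> and the other to \<open>Y\<close> gives the bound.\<close>
  have 1: "(c f + u f) + (c g - u g) \<le> X + Y"
    using contr[OF f(1) g(1)] X Y by linarith
  have 2: "c f + u f \<le> max X Y" using bound[OF f(1)] X Y by linarith
  have 3: "c g - u g \<le> max X Y" using bound[OF g(1)] X Y by linarith
  have m: "max (l * X) (l * Y) = l * max X Y" using l by (simp add: max_mult_distrib_left)
  have "exp (l * (c f + u f)) + exp (l * (c g - u g)) \<le> exp (l * X) + exp (l * Y)"
    using mult_left_mono[OF 1 l] mult_left_mono[OF 2 l] mult_left_mono[OF 3 l]
    by (intro exp_sum_weak_majorization) (auto simp: m distrib_left)
  then show ?thesis unfolding f(2) g(2) X_def Y_def .
qed

text \<open>Since \<open>X - x = y - Y\<close>, the two differences of powers share this factor, and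
  the cofactors compare term by term because \<open>y \<le> X\<close> and
  \<open>Y \<le> x\<close>.\<close>

lemma power_sum_majorization:
  fixes x y X Y :: real
  assumes "x + y = X + Y" "0 \<le> Y" "Y \<le> x" "x \<le> X"
  shows "x ^ k + y ^ k \<le> X ^ k + Y ^ k"
proof -
  have y: "y \<le> X" "Y \<le> y" using assms by auto
  have "X ^ k - x ^ k = (X - x) * (\<Sum>i<k. X ^ i * x ^ (k - Suc i))"
    using power_diff_sumr2[of X k x] by (simp add: mult.commute)
  moreover have "y ^ k - Y ^ k = (y - Y) * (\<Sum>i<k. y ^ i * Y ^ (k - Suc i))"
    using power_diff_sumr2[of y k Y] by (simp add: mult.commute)
  moreover have "(\<Sum>i<k. y ^ i * Y ^ (k - Suc i)) \<le> (\<Sum>i<k. X ^ i * x ^ (k - Suc i))"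
    using assms y by (intro sum_mono mult_mono power_mono zero_le_power) auto
  moreover have "y - Y = X - x" "0 \<le> X - x" using assms by auto
  ultimately have "y ^ k - Y ^ k \<le> X ^ k - x ^ k" by (simp add: mult_left_mono)
  then show ?thesis by simp
qed

lemma cosh_sums_even: "(\<lambda>k. x ^ (2 * k) / fact (2 * k)) sums cosh (x::real)"
proof -
  have "strict_mono (\<lambda>k::nat. 2 * k)" by (simp add: strict_mono_def)
  from sums_mono_reindex[OF this, of "\<lambda>n. if even n then x ^ n /\<^sub>R fact n else 0" "cosh x"]
  have "(\<lambda>k. if even (2*k) then x ^ (2*k) /\<^sub>R fact (2*k) else 0) sums cosh x"
    using cosh_converges[of x] by (force elim!: evenE)
  then show ?thesis by (simp add: divide_inverse mult.commute)
qed

text \<open>\<open>cosh\<close> is a power series with nonnegative coefficients in the square of its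
  argument, so the majorization of the squares applies in each degree.\<close>

lemma cosh_sum_majorization:
  fixes p q A B :: real
  assumes "p\<^sup>2 + q\<^sup>2 = A\<^sup>2 + B\<^sup>2" "B\<^sup>2 \<le> p\<^sup>2" "p\<^sup>2 \<le> A\<^sup>2"
  shows "cosh p + cosh q \<le> cosh A + cosh B"
proof (rule sums_le)
  show "(\<lambda>k. p ^ (2*k) / fact (2*k) + q ^ (2*k) / fact (2*k)) sums (cosh p + cosh q)"
    by (intro sums_add cosh_sums_even)
  show "(\<lambda>k. A ^ (2*k) / fact (2*k) + B ^ (2*k) / fact (2*k)) sums (cosh A + cosh B)"
    by (intro sums_add cosh_sums_even)
  fix k
  have "(p\<^sup>2) ^ k + (q\<^sup>2) ^ k \<le> (A\<^sup>2) ^ k + (B\<^sup>2) ^ k"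
    using assms by (intro power_sum_majorization) auto
  then show "p ^ (2*k) / fact (2*k) + q ^ (2*k) / fact (2*k) \<le> A ^ (2*k) / fact (2*k) + B ^ (2*k) / fact (2*k)"
    by (simp add: power_mult add_divide_distrib[symmetric] divide_right_mono)
qed

text \<open>Termwise comparison of the two series, resting on
  \<open>2 ^ k * fact k \<le> fact (2 * k)\<close>.\<close>

lemma cosh_le_exp_half_square: "cosh (x::real) \<le> exp (x\<^sup>2 / 2)"
proof (rule sums_le)
  show "(\<lambda>k. x ^ (2 * k) / fact (2 * k)) sums cosh x" by (rule cosh_sums_even)
  show "(\<lambda>k. (x\<^sup>2 / 2) ^ k /\<^sub>R fact k) sums exp (x\<^sup>2 / 2)" by (rule exp_converges)
  fix k
  have "(2::real) ^ k * fact k \<le> fact (2 * k)"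
  proof (induction k)
    case (Suc k)
    have "(2::real) ^ Suc k * fact (Suc k) = (2 * (real k + 1)) * (2 ^ k * fact k)" by simp
    also have "\<dots> \<le> (real (2 * k + 2) * real (2 * k + 1)) * fact (2 * k)"
      by (intro mult_mono Suc.IH) (simp_all add: field_simps)
    also have "\<dots> = fact (2 * Suc k)" by (simp add: algebra_simps)
    finally show ?case .
  qed simp
  then have "(x\<^sup>2) ^ k / fact (2 * k) \<le> (x\<^sup>2) ^ k / (2 ^ k * fact k)"
    by (intro divide_left_mono) auto
  moreover have "(x\<^sup>2) ^ k / (2 ^ k * fact k) = (x\<^sup>2 / 2) ^ k /\<^sub>R fact k"
    by (simp only: power_divide scaleR_conv_of_real of_real_inverse of_real_fact divide_inverse
        inverse_mult_distrib power_mult_distrib power_inverse mult_ac of_real_eq_id id_apply)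
  moreover have "x ^ (2 * k) = (x\<^sup>2) ^ k" by (rule power_mult)
  ultimately show "x ^ (2 * k) / fact (2 * k) \<le> (x\<^sup>2 / 2) ^ k /\<^sub>R fact k" by simp
qed

text \<open>The squared norms of sum and difference have the same total as
  \<open>(A + B)\<^sup>2\<close> and \<open>(A - B)\<^sup>2\<close>, and by Cauchy-Schwarz they lie
  between these two. Averaging over a sign thus costs no more than for collinear vectors, in any
  dimension.\<close>

lemma cosh_vnorm_add_le:
  fixes c :: real
  shows "cosh (c * vnorm d (\<lambda>i. f i + g i)) + cosh (c * vnorm d (\<lambda>i. f i - g i))
       \<le> 2 * cosh (c * vnorm d f) * cosh (c * vnorm d g)"
proof -
  define A where "A = vnorm d f"
  define B where "B = vnorm d g"
  have p: "(vnorm d (\<lambda>i. f i + g i))\<^sup>2 = A\<^sup>2 + 2 * vinner d f g + B\<^sup>2"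
    using vnorm_add_sq[of d f 1 g] by (simp add: A_def B_def)
  have q: "(vnorm d (\<lambda>i. f i - g i))\<^sup>2 = A\<^sup>2 - 2 * vinner d f g + B\<^sup>2"
    using vnorm_add_sq[of d f "-1" g] by (simp add: A_def B_def)
  have ip: "\<bar>vinner d f g\<bar> \<le> A * B" unfolding A_def B_def by (rule vinner_le)
  have "cosh (c * vnorm d (\<lambda>i. f i + g i)) + cosh (c * vnorm d (\<lambda>i. f i - g i))
     \<le> cosh (c * (A + B)) + cosh (c * (A - B))"
  proof (rule cosh_sum_majorization)
    show "(c * vnorm d (\<lambda>i. f i + g i))\<^sup>2 + (c * vnorm d (\<lambda>i. f i - g i))\<^sup>2
        = (c * (A + B))\<^sup>2 + (c * (A - B))\<^sup>2"
      unfolding power_mult_distrib p q by (simp add: power2_sum power2_diff algebra_simps)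
    show "(c * (A - B))\<^sup>2 \<le> (c * vnorm d (\<lambda>i. f i + g i))\<^sup>2"
      unfolding power_mult_distrib p using ip by (intro mult_left_mono) (simp_all add: power2_diff)
    show "(c * vnorm d (\<lambda>i. f i + g i))\<^sup>2 \<le> (c * (A + B))\<^sup>2"
      unfolding power_mult_distrib p using ip by (intro mult_left_mono) (simp_all add: power2_sum)
  qed
  also have "\<dots> = 2 * cosh (c * A) * cosh (c * B)"
    by (simp add: distrib_left right_diff_distrib cosh_add cosh_diff)
  finally show ?thesis by (simp add: A_def B_def)
qed

section \<open>The noise distribution\<close>

text \<open>Fubini splits off one coordinate at a time, and the affine substitution on the line
  contributes one factor \<open>s\<close> for each.\<close>

lemma nn_integral_PiM_lborel_scale:
  fixes f :: "('i \<Rightarrow> real) \<Rightarrow> ennreal"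
  assumes I: "finite I" and s: "0 < s" and f: "f \<in> borel_measurable (PiM I (\<lambda>_. lborel))"
  shows "(\<integral>\<^sup>+x. f x \<partial>PiM I (\<lambda>_. lborel))
       = ennreal (s ^ card I) * (\<integral>\<^sup>+x. f (\<lambda>i\<in>I. s * x i) \<partial>PiM I (\<lambda>_. lborel))"
  using I f
proof (induction I arbitrary: f rule: finite_induct)
  case empty
  then show ?case by (simp add: PiM_empty nn_integral_count_space_finite)
next
  case (insert i I)
  interpret product_sigma_finite "\<lambda>_::'i. lborel :: real measure" by standard
  note [measurable] = insert.prems
  let ?P = "\<lambda>I. PiM I (\<lambda>_. lborel :: real measure)"
  have [measurable]: "(\<lambda>x. \<lambda>j\<in>J. s * x j) \<in> ?P J \<rightarrow>\<^sub>M ?P J" for J :: "'i set"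
    by measurable
  have "(\<integral>\<^sup>+x. f x \<partial>?P (insert i I)) = (\<integral>\<^sup>+x. (\<integral>\<^sup>+y. f (x(i := y)) \<partial>lborel) \<partial>?P I)"
    by (rule product_nn_integral_insert) (use insert in auto)
  also have "\<dots> = (\<integral>\<^sup>+x. ennreal s * (\<integral>\<^sup>+y. f (x(i := s * y)) \<partial>lborel) \<partial>?P I)"
  proof (rule nn_integral_cong)
    fix x assume x: "x \<in> space (?P I)"
    have "(\<lambda>y. f (x(i := y))) \<in> borel_measurable borel"
      using measurable_comp[OF measurable_component_update[OF x insert.hyps(2)] insert.prems]
      by (simp add: comp_def)
    from nn_integral_real_affine[OF this, of s 0] s
    show "(\<integral>\<^sup>+y. f (x(i := y)) \<partial>lborel) = ennreal s * (\<integral>\<^sup>+y. f (x(i := s * y)) \<partial>lborel)" by simp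
  qed
  also have "\<dots> = ennreal s * (\<integral>\<^sup>+x. (\<integral>\<^sup>+y. f (x(i := s * y)) \<partial>lborel) \<partial>?P I)"
    by (rule nn_integral_cmult) measurable
  also have "(\<integral>\<^sup>+x. (\<integral>\<^sup>+y. f (x(i := s * y)) \<partial>lborel) \<partial>?P I)
     = ennreal (s ^ card I) * (\<integral>\<^sup>+x. (\<integral>\<^sup>+y. f ((\<lambda>j\<in>I. s * x j)(i := s * y)) \<partial>lborel) \<partial>?P I)"
    by (rule insert.IH) measurable
  also have "(\<integral>\<^sup>+x. (\<integral>\<^sup>+y. f ((\<lambda>j\<in>I. s * x j)(i := s * y)) \<partial>lborel) \<partial>?P I)
     = (\<integral>\<^sup>+x. (\<integral>\<^sup>+y. f (\<lambda>j\<in>insert i I. s * (x(i := y)) j) \<partial>lborel) \<partial>?P I)"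
  proof (intro nn_integral_cong arg_cong[where f = f])
    fix x :: "'i \<Rightarrow> real" and y :: real
    show "(\<lambda>j\<in>I. s * x j)(i := s * y) = (\<lambda>j\<in>insert i I. s * (x(i := y)) j)"
      using insert.hyps(2) by (auto simp: fun_eq_iff)
  qed
  also have "\<dots> = (\<integral>\<^sup>+x. f (\<lambda>j\<in>insert i I. s * x j) \<partial>?P (insert i I))"
    using insert.hyps by (intro product_nn_integral_insert[symmetric]) measurable
  also have "ennreal s * (ennreal (s ^ card I) * \<dots>)
     = ennreal (s ^ card (insert i I)) * (\<integral>\<^sup>+x. f (\<lambda>j\<in>insert i I. s * x j) \<partial>?P (insert i I))"
    using insert.hyps s by (simp add: ennreal_mult mult.assoc)
  finally show ?case .
qed

text \<open>The norm is homogeneous, so dilating space amounts to changing the rate. This compares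
  normalizing constants without polar coordinates.\<close>

lemma nn_integral_exp_vnorm_scale:
  assumes s: "0 < s"
  shows "(\<integral>\<^sup>+e. ennreal (exp (- c * vnorm d e)) \<partial>lebd d)
       = ennreal (s ^ d) * (\<integral>\<^sup>+e. ennreal (exp (- (c * s) * vnorm d e)) \<partial>lebd d)"
proof -
  have "vnorm d (\<lambda>i\<in>{..<d}. s * e i) = s * vnorm d e" for e
  proof -
    have "vnorm d (\<lambda>i\<in>{..<d}. s * e i) = vnorm d (\<lambda>i. s * e i)" by (simp add: vnorm_def)
    then show ?thesis using s by (simp add: vnorm_scale)
  qed
  then show ?thesis
    using nn_integral_PiM_lborel_scale[of "{..<d}" s "\<lambda>e. ennreal (exp (- c * vnorm d e))"] s
    by (simp add: lebd_def[symmetric] mult.assoc)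
qed

lemma nn_integral_exp_abs_finite:
  assumes "0 < c"
  shows "(\<integral>\<^sup>+x. ennreal (exp (- c * \<bar>x\<bar>)) \<partial>lborel) < \<infinity>"
proof -
  have "((\<lambda>x. exp (- c * x)) has_integral exp (- c * 0) / c) {0..}"
    using assms by (rule has_integral_exp_minus_to_infinity)
  then have half: "(\<integral>\<^sup>+x. ennreal (exp (- c * x)) * indicator {0..} x \<partial>lborel) = ennreal (1 / c)"
    using assms by (subst nn_integral_has_integral_lebesgue'[where I = "exp (- c * 0) / c"]) auto
  have neg: "(\<integral>\<^sup>+x. ennreal (exp (c * x)) * indicator {..0} x \<partial>lborel) = ennreal (1 / c)"
    using nn_integral_real_affine[of "\<lambda>x. ennreal (exp (- c * x)) * indicator {0..} x" "-1" 0]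
      half
    by (simp add: indicator_def cong: if_cong)
  have "(\<integral>\<^sup>+x. ennreal (exp (- c * \<bar>x\<bar>)) \<partial>lborel)
     \<le> (\<integral>\<^sup>+x. ennreal (exp (- c * x)) * indicator {0..} x + ennreal (exp (c * x)) * indicator {..0} x \<partial>lborel)"
    by (intro nn_integral_mono) (auto simp: indicator_def)
  also have "\<dots> = ennreal (1 / c) + ennreal (1 / c)"
    using half neg by (subst nn_integral_add) auto
  finally show ?thesis by (auto simp: less_top[symmetric] top_unique)
qed

text \<open>The norm dominates each coordinate and hence the mean of their absolute values, so the
  integrand is bounded by a product of one-dimensional exponentials of rate
  \<open>c / real d\<close>.\<close>

lemma nn_integral_exp_vnorm_finite:
  assumes c: "0 < c" and d: "0 < d"
  shows "(\<integral>\<^sup>+e. ennreal (exp (- c * vnorm d e)) \<partial>lebd d) < \<infinity>"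
proof -
  interpret product_sigma_finite "\<lambda>_::nat. lborel :: real measure" by standard
  have "(\<integral>\<^sup>+e. ennreal (exp (- c * vnorm d e)) \<partial>lebd d)
     \<le> (\<integral>\<^sup>+e. (\<Prod>i<d. ennreal (exp (- (c / real d) * \<bar>e i\<bar>))) \<partial>lebd d)"
  proof (rule nn_integral_mono)
    fix e :: "nat \<Rightarrow> real"
    have "(\<Sum>i<d. c / real d * \<bar>e i\<bar>) \<le> (\<Sum>i<d. c / real d * vnorm d e)"
      using c by (intro sum_mono mult_left_mono abs_coord_le_vnorm) auto
    then have "exp (- c * vnorm d e) \<le> exp (\<Sum>i<d. - (c / real d) * \<bar>e i\<bar>)"
      using d by (simp add: sum_negf)
    then show "ennreal (exp (- c * vnorm d e)) \<le> (\<Prod>i<d. ennreal (exp (- (c / real d) * \<bar>e i\<bar>)))"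
      by (simp add: exp_sum prod_ennreal ennreal_leI)
  qed
  also have "\<dots> = (\<Prod>i<d. \<integral>\<^sup>+x. ennreal (exp (- (c / real d) * \<bar>x\<bar>)) \<partial>lborel)"
    unfolding lebd_def by (rule product_nn_integral_prod) auto
  also have "\<dots> < \<infinity>"
    using c d nn_integral_exp_abs_finite[of "c / real d"] by (auto simp: power_eq_top_ennreal less_top[symmetric])
  finally show ?thesis .
qed

text \<open>A positive integrand with integral zero would make the whole space null, yet the unit
  cube has measure one.\<close>

lemma nn_integral_exp_vnorm_pos: "0 < (\<integral>\<^sup>+e. ennreal (exp (- c * vnorm d e)) \<partial>lebd d)"
proof (rule ccontr)
  interpret product_sigma_finite "\<lambda>_::nat. lborel :: real measure" by standard
  assume "\<not> ?thesis"
  then have "AE e in lebd d. ennreal (exp (- c * vnorm d e)) = 0"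
    by (subst nn_integral_0_iff_AE[symmetric]) auto
  then have "AE e in lebd d. False" by simp
  then have "emeasure (lebd d) (space (lebd d)) = 0"
    by (simp add: AE_iff_measurable[of "space (lebd d)"])
  moreover have "emeasure (lebd d) (PiE {..<d} (\<lambda>_. {0..1})) = 1"
    unfolding lebd_def by (subst emeasure_PiM) auto
  moreover have "emeasure (lebd d) (PiE {..<d} (\<lambda>_. {0..1})) \<le> emeasure (lebd d) (space (lebd d))"
    by (rule emeasure_space)
  ultimately show False by simp
qed

text \<open>\<open>noise\<close> normalizes by a Bochner integral, whose default value 0 would turn
  the density into 0. Integrability and positivity identify it with the nonnegative integral, which
  is easier to compute with.\<close>

lemma noise_eq_density:
  assumes a: "0 < a" and d: "0 < d"
  shows "noise d a = density (lebd d) (\<lambda>e. ennreal (exp (- (a/2) * vnorm d e))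
            / (\<integral>\<^sup>+e. ennreal (exp (- (a/2) * vnorm d e)) \<partial>lebd d))"
proof -
  let ?g = "\<lambda>e. exp (- (a/2) * vnorm d e)"
  have "integrable (lebd d) ?g"
    using nn_integral_exp_vnorm_finite[of "a/2" d] a d by (intro integrableI_nonneg) auto
  then have eq: "(\<integral>\<^sup>+e. ennreal (?g e) \<partial>lebd d) = ennreal (\<integral>e. ?g e \<partial>lebd d)"
    by (intro nn_integral_eq_integral) auto
  with nn_integral_exp_vnorm_pos[of d "a/2"] have "0 < (\<integral>e. ?g e \<partial>lebd d)" by simp
  then show ?thesis unfolding noise_def eq by (simp add: divide_ennreal)
qed

lemma prob_space_noise:
  assumes a: "0 < a" and d: "0 < d"
  shows "prob_space (noise d a)"
proof
  let ?I = "\<integral>\<^sup>+e. ennreal (exp (- (a/2) * vnorm d e)) \<partial>lebd d"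
  have I: "0 < ?I" "?I < \<infinity>"
    using nn_integral_exp_vnorm_pos[of d "a/2"] nn_integral_exp_vnorm_finite[of "a/2" d] a d by auto
  have "emeasure (noise d a) (space (noise d a))
     = (\<integral>\<^sup>+e. ennreal (exp (- (a/2) * vnorm d e)) / ?I \<partial>lebd d)"
    unfolding noise_eq_density[OF a d] by (subst emeasure_density) (auto intro!: nn_integral_cong)
  also have "\<dots> = ?I / ?I" by (rule nn_integral_divide) measurable
  also have "\<dots> = 1" using I by (intro ennreal_divide_self) auto
  finally show "emeasure (noise d a) (space (noise d a)) = 1" .
qed

lemma sets_noise [measurable_cong]: "sets (noise d a) = sets (lebd d)"
  by (simp add: noise_def)

text \<open>Chernoff: halving the rate multiplies the total mass of \<open>exp (- a/2 |e|)\<close> by \<open>2 ^ d\<close>.\<close>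

lemma noise_tail:
  assumes a: "0 < a" and d: "0 < d" and \<delta>: "0 < \<delta>" "\<delta> < 1/2"
    and T: "8 * real d * ln (real d / \<delta>) / a \<le> T"
  shows "measure (noise d a) {e \<in> space (noise d a). T < vnorm d e} \<le> \<delta>"
proof -
  interpret prob_space "noise d a" using a d by (rule prob_space_noise)
  let ?I = "\<lambda>c. \<integral>\<^sup>+e. ennreal (exp (- c * vnorm d e)) \<partial>lebd d"
  have I: "0 < ?I (a/2)" "?I (a/2) < \<infinity>"
    using nn_integral_exp_vnorm_pos[of d "a/2"] nn_integral_exp_vnorm_finite[of "a/2" d] a d by auto
  have "emeasure (noise d a) {e \<in> space (noise d a). T < vnorm d e}
     = (\<integral>\<^sup>+e. ennreal (exp (- (a/2) * vnorm d e)) / ?I (a/2) * indicator {e \<in> space (lebd d). T < vnorm d e} e \<partial>lebd d)"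
    unfolding noise_eq_density[OF a d] by (subst emeasure_density) auto
  also have "\<dots> \<le> (\<integral>\<^sup>+e. ennreal (exp (- (a/4) * T)) * ennreal (exp (- (a/4) * vnorm d e)) / ?I (a/2) \<partial>lebd d)"
  proof (rule nn_integral_mono)
    fix e
    \<comment> \<open>On the tail event half of the exponent pays for the factor
      \<open>exp (- (a/4) * T)\<close>; the other half remains integrable.\<close>
    have "exp (- (a/2) * vnorm d e) \<le> exp (- (a/4) * T) * exp (- (a/4) * vnorm d e)" if "T < vnorm d e"
      unfolding exp_add[symmetric] using that a by (simp add: field_simps)
    then show "ennreal (exp (- (a/2) * vnorm d e)) / ?I (a/2) * indicator {e \<in> space (lebd d). T < vnorm d e} e
        \<le> ennreal (exp (- (a/4) * T)) * ennreal (exp (- (a/4) * vnorm d e)) / ?I (a/2)"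
      by (auto simp: indicator_def ennreal_mult[symmetric] intro!: divide_right_mono_ennreal ennreal_leI)
  qed
  also have "\<dots> = ennreal (exp (- (a/4) * T)) * ?I (a/4) / ?I (a/2)"
    by (simp add: nn_integral_divide nn_integral_cmult)
  also have "?I (a/4) = ennreal (2 ^ d) * ?I (a/2)"
    using nn_integral_exp_vnorm_scale[of 2 d "a/4"] by simp
  also have "ennreal (exp (- (a/4) * T)) * (ennreal (2 ^ d) * ?I (a/2)) / ?I (a/2)
      = ennreal (exp (- (a/4) * T) * 2 ^ d)"
    using I by (simp add: ennreal_mult mult.assoc[symmetric] ennreal_mult_divide_eq less_top[symmetric])
  \<comment> \<open>The threshold makes \<open>(a / 4) * T\<close> at least twice
    \<open>real d * ln (real d / \<delta>)\<close>. As \<open>\<delta> < 1/2\<close>, one copy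
    absorbs \<open>real d * ln 2\<close> and the other \<open>ln (1 / \<delta>)\<close>.\<close>
  also have "exp (- (a/4) * T) * 2 ^ d \<le> \<delta>"
  proof -
    have d1: "1 \<le> real d" using d by simp
    have l0: "ln 2 \<le> ln (1 / \<delta>)" using \<delta> by (subst ln_le_cancel_iff) (auto simp: field_simps)
    have l1: "ln (1 / \<delta>) \<le> ln (real d / \<delta>)"
      using \<delta> d1 by (subst ln_le_cancel_iff) (auto simp: divide_right_mono)
    have l2: "0 \<le> ln (1 / \<delta>)" using l0 ln_ge_zero[of "2::real"] by linarith
    have "real d * ln 2 \<le> real d * ln (real d / \<delta>)" using l0 l1 by (intro mult_left_mono) auto
    moreover have "1 * ln (1 / \<delta>) \<le> real d * ln (real d / \<delta>)"
      using l1 l2 d1 by (intro mult_mono) auto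
    moreover have "2 * (real d * ln (real d / \<delta>)) \<le> (a / 4) * T"
      using T a by (simp add: field_simps)
    ultimately have "- (a / 4) * T + real d * ln 2 \<le> ln \<delta>"
      using \<delta> by (simp add: ln_div)
    then have "exp (- (a / 4) * T + real d * ln 2) \<le> exp (ln \<delta>)" by simp
    then show ?thesis using \<delta> unfolding exp_add exp_of_nat_mult by simp
  qed
  finally show ?thesis using \<delta> by (simp add: emeasure_eq_measure ennreal_leI)
qed

section \<open>Uniform deviations of the empirical risk\<close>

text \<open>Floor or ceiling is taken according to the sign, so absolute values never grow; this
  keeps grid points inside a ball.\<close>

lemma round_towards_zero:
  fixes u s :: real
  assumes s: "0 < s"
  obtains k :: int where "\<bar>s * of_int k\<bar> \<le> \<bar>u\<bar>" "\<bar>u - s * of_int k\<bar> \<le> s"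
proof (cases "0 \<le> u")
  case True
  have 1: "s * of_int \<lfloor>u / s\<rfloor> \<le> u" using floor_divide_lower[OF s, of u] by (simp add: mult.commute)
  have 2: "u \<le> s * of_int \<lfloor>u / s\<rfloor> + s"
    using floor_divide_upper[OF s, of u] by (simp add: algebra_simps)
  have 3: "0 \<le> s * of_int \<lfloor>u / s\<rfloor>" using True s by simp
  show ?thesis by (rule that[of "\<lfloor>u / s\<rfloor>"]) (use 1 2 3 in auto)
next
  case False
  have 1: "u \<le> s * of_int \<lceil>u / s\<rceil>" using ceiling_divide_upper[OF s, of u] by (simp add: mult.commute)
  have 2: "s * of_int \<lceil>u / s\<rceil> - s \<le> u"
    using ceiling_divide_lower[OF s, of u] by (simp add: algebra_simps)
  have "\<lceil>u / s\<rceil> \<le> 0" using False s by (simp add: ceiling_le_iff divide_le_0_iff)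
  then have 3: "s * of_int \<lceil>u / s\<rceil> \<le> 0" using s by (simp add: mult_le_0_iff)
  show ?thesis by (rule that[of "\<lceil>u / s\<rceil>"]) (use 1 2 3 in auto)
qed

lemma vnorm_mono: "(\<And>i. i < d \<Longrightarrow> \<bar>f i\<bar> \<le> \<bar>g i\<bar>) \<Longrightarrow> vnorm d f \<le> vnorm d g"
  unfolding vnorm_def by (intro real_sqrt_le_mono sum_mono) (auto simp: abs_le_square_iff)

lemma vnorm_le_sum: "vnorm d f \<le> (\<Sum>i<d. \<bar>f i\<bar>)"
  unfolding vnorm_eq_L2_set by (rule L2_set_le_sum_abs)

text \<open>The grid is centred at \<open>h\<close> and rounding goes towards \<open>h\<close>, so
  the rounded point stays in the ball. Finiteness is enough, because the later moment bound does not
  involve the number of points.\<close>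

lemma finite_ball_net:
  fixes h :: "nat \<Rightarrow> real"
  assumes r: "0 \<le> r" and \<xi>: "0 < \<xi>"
  obtains F where "finite F" "F \<noteq> {}" "\<And>f. f \<in> F \<Longrightarrow> vnorm d (\<lambda>i. f i - h i) \<le> r"
    "\<And>f. vnorm d (\<lambda>i. f i - h i) \<le> r \<Longrightarrow> \<exists>g\<in>F. vnorm d (\<lambda>i. f i - g i) \<le> \<xi>"
proof -
  \<comment> \<open>The denominator \<open>Suc d\<close> lets the \<open>d\<close> coordinate errors
    sum to at most \<open>\<xi>\<close> and stays positive for \<open>d = 0\<close>.\<close>
  define s where "s = \<xi> / real (Suc d)"
  have s: "0 < s" using \<xi> by (simp add: s_def)
  define N where "N = \<lceil>r / s\<rceil>"
  define F where "F = {g \<in> (\<Pi>\<^sub>E i\<in>{..<d}. (\<lambda>k::int. h i + s * of_int k) ` {- N..N}). vnorm d (\<lambda>i. g i - h i) \<le> r}"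
  have fin: "finite F"
    unfolding F_def by (intro finite_Collect_conjI disjI1) (simp add: finite_PiE)
  have cover: "\<exists>g\<in>F. vnorm d (\<lambda>i. f i - g i) \<le> \<xi>" if f: "vnorm d (\<lambda>i. f i - h i) \<le> r" for f
  proof -
    have "\<forall>i. \<exists>k::int. \<bar>s * of_int k\<bar> \<le> \<bar>f i - h i\<bar> \<and> \<bar>(f i - h i) - s * of_int k\<bar> \<le> s"
      using round_towards_zero[OF s] by metis
    then obtain k :: "nat \<Rightarrow> int" where k: "\<And>i. \<bar>s * of_int (k i)\<bar> \<le> \<bar>f i - h i\<bar>"
      "\<And>i. \<bar>(f i - h i) - s * of_int (k i)\<bar> \<le> s" by metis
    define g where "g = (\<lambda>i\<in>{..<d}. h i + s * of_int (k i))"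
    have "k i \<in> {- N..N}" if i: "i < d" for i
    proof -
      have "s * \<bar>of_int (k i)\<bar> \<le> r"
        using k(1)[of i] abs_coord_le_vnorm[OF i, of "\<lambda>i. f i - h i"] f s by (simp add: abs_mult)
      then have "of_int \<bar>k i\<bar> \<le> r / s" using s by (simp add: field_simps)
      then have "of_int \<bar>k i\<bar> \<le> (of_int N :: real)" unfolding N_def using le_of_int_ceiling[of "r / s"] by linarith
      then have "\<bar>k i\<bar> \<le> N" by linarith
      then show ?thesis by auto
    qed
    moreover have "vnorm d (\<lambda>i. g i - h i) \<le> r"
      using k(1) by (intro order_trans[OF vnorm_mono f]) (auto simp: g_def)
    ultimately have "g \<in> F" unfolding F_def g_def by auto
    moreover have "vnorm d (\<lambda>i. f i - g i) \<le> \<xi>"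
    proof -
      have "(\<Sum>i<d. \<bar>f i - g i\<bar>) \<le> (\<Sum>i<d. s)"
        using k(2) by (intro sum_mono) (auto simp: g_def algebra_simps)
      also have "\<dots> \<le> \<xi>" using \<xi> by (simp add: s_def field_simps)
      finally show ?thesis using vnorm_le_sum[of d "\<lambda>i. f i - g i"] by linarith
    qed
    ultimately show ?thesis by blast
  qed
  moreover have "F \<noteq> {}" using cover[of h] r by (auto simp: vnorm_def)
  ultimately show ?thesis using fin by (intro that[of F]) (auto simp: F_def)
qed

lemma ennreal_divide_two: "0 \<le> x \<Longrightarrow> ennreal (x / 2) = ennreal (1/2) * ennreal x"
  by (subst ennreal_mult[symmetric]) auto

text \<open>The derivative bound on the loss enters as 1-Lipschitz continuity. The support condition
  holds almost everywhere, as \<open>P\<close> is a measure on all of R^d times R.\<close>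

locale margin_loss = prob_space P for P :: "((nat \<Rightarrow> real) \<times> real) measure" +
  fixes L :: "real \<Rightarrow> real" and d :: nat
  assumes sets_P [measurable_cong]: "sets P = sets (lebd d \<Otimes>\<^sub>M lborel)"
    and Lipschitz: "\<bar>L a - L b\<bar> \<le> \<bar>a - b\<bar>"
    and AE_unit: "AE z in P. vnorm d (fst z) \<le> 1 \<and> (snd z = 1 \<or> snd z = -1)"
begin

definition unit_sample :: "(nat \<Rightarrow> real) \<times> real \<Rightarrow> bool" where
  "unit_sample z \<longleftrightarrow> vnorm d (fst z) \<le> 1 \<and> (snd z = 1 \<or> snd z = -1)"

definition margin :: "(nat \<Rightarrow> real) \<Rightarrow> (nat \<Rightarrow> real) \<times> real \<Rightarrow> real" where
  "margin f z = snd z * vinner d f (fst z)"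

definition risk :: "(nat \<Rightarrow> real) \<Rightarrow> real" where
  "risk f = (\<integral>z. L (margin f z) \<partial>P)"

lemma isCont_L: "isCont L a"
proof -
  have "1-lipschitz_on UNIV L" using Lipschitz by (intro lipschitz_onI) (auto simp: dist_real_def)
  then show ?thesis using lipschitz_on_continuous_on continuous_on_eq_continuous_at by blast
qed

lemma measurable_L [measurable]: "L \<in> borel_measurable borel"
  by (intro borel_measurable_continuous_onI continuous_at_imp_continuous_on ballI isCont_L)

lemma measurable_margin [measurable]: "margin f \<in> borel_measurable P"
  unfolding margin_def vinner_def by measurable

lemma measurable_unit_sample [measurable]: "Measurable.pred P unit_sample"
  unfolding unit_sample_def by measurable

lemma AE_unit_sample: "AE z in P. unit_sample z"
  using AE_unit by (simp add: unit_sample_def)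

lemma margin_diff: "margin f z - margin g z = margin (\<lambda>i. f i - g i) z"
  by (simp add: margin_def vinner_diff_left right_diff_distrib)

lemma abs_margin_le:
  assumes "unit_sample z" shows "\<bar>margin f z\<bar> \<le> vnorm d f"
proof -
  have "\<bar>margin f z\<bar> = \<bar>vinner d f (fst z)\<bar>"
    using assms by (auto simp: margin_def unit_sample_def)
  also have "\<dots> \<le> vnorm d f * 1"
    using assms by (intro order_trans[OF vinner_le] mult_left_mono) (auto simp: unit_sample_def)
  finally show ?thesis by simp
qed

lemma loss_diff_le:
  assumes "unit_sample z" shows "\<bar>L (margin f z) - L (margin g z)\<bar> \<le> vnorm d (\<lambda>i. f i - g i)"
  using Lipschitz[of "margin f z" "margin g z"] abs_margin_le[OF assms, of "\<lambda>i. f i - g i"]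
  by (simp add: margin_diff)

lemma integrable_loss [simp]: "integrable P (\<lambda>z. L (margin f z))"
proof (rule integrable_const_bound)
  show "AE z in P. norm (L (margin f z)) \<le> \<bar>L 0\<bar> + vnorm d f"
    using AE_unit_sample
  proof eventually_elim
    case (elim z)
    then show ?case using Lipschitz[of "margin f z" 0] abs_margin_le[OF elim, of f] by simp
  qed
qed measurable

lemma risk_diff_le: "\<bar>risk f - risk g\<bar> \<le> vnorm d (\<lambda>i. f i - g i)"
proof -
  have "risk f - risk g = (\<integral>z. L (margin f z) - L (margin g z) \<partial>P)" by (simp add: risk_def)
  also have "\<bar>\<dots>\<bar> \<le> (\<integral>z. \<bar>L (margin f z) - L (margin g z)\<bar> \<partial>P)"
    by (rule integral_abs_bound)
  also have "\<dots> \<le> (\<integral>z. vnorm d (\<lambda>i. f i - g i) \<partial>P)"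
    using AE_unit_sample by (intro integral_mono_AE) (auto elim!: eventually_mono intro: loss_diff_le)
  finally show ?thesis by (simp add: prob_space)
qed

section \<open>Symmetrization and contraction for one sample\<close>

context
  fixes F :: "(nat \<Rightarrow> real) set" and h :: "nat \<Rightarrow> real" and r l :: real
  assumes F: "finite F" "F \<noteq> {}" and l: "0 \<le> l" and r: "0 \<le> r"
    and ball: "\<And>f. f \<in> F \<Longrightarrow> vnorm d (\<lambda>i. f i - h i) \<le> r"
begin

abbreviation excess :: "(nat \<Rightarrow> real) \<Rightarrow> (nat \<Rightarrow> real) \<times> real \<Rightarrow> real" where
  "excess f z \<equiv> L (margin f z) - L (margin h z)"

lemma F_Max_ge: "f \<in> F \<Longrightarrow> w f \<le> (MAX f\<in>F. w f :: real)"
  using F by (intro Max_ge) auto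

lemma F_Max_attained: obtains f where "f \<in> F" "(MAX f\<in>F. w f :: real) = w f"
proof -
  have "(MAX f\<in>F. w f) \<in> w ` F" using F by (intro Max_in) auto
  then show ?thesis using that by auto
qed

text \<open>Jensen for \<open>exp\<close> is applied at the single \<open>f\<close> that attains the
  left-hand maximum; on the right the maximum dominates this \<open>f\<close> pointwise.\<close>

lemma exp_Max_expectation_le:
  fixes c :: "(nat \<Rightarrow> real) \<Rightarrow> real"
  shows "ennreal (exp (l * (MAX f\<in>F. c f + 2 * (risk f - risk h))))
    \<le> (\<integral>\<^sup>+z. ennreal (exp (l * (MAX f\<in>F. c f + 2 * excess f z))) \<partial>P)"
proof -
  obtain f where f: "f \<in> F" "(MAX f\<in>F. c f + 2 * (risk f - risk h)) = c f + 2 * (risk f - risk h)"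
    by (rule F_Max_attained)
  define X where "X z = l * (c f + 2 * excess f z)" for z
  have [measurable]: "X \<in> borel_measurable P" unfolding X_def by measurable
  have iX: "integrable P X" unfolding X_def by (auto intro!: integrable_add integrable_diff integrable_mult_right)
  have EX: "expectation X = l * (c f + 2 * (risk f - risk h))"
    by (simp add: X_def[abs_def] risk_def prob_space)
  have ie: "integrable P (\<lambda>z. exp (X z))"
  proof (rule integrable_const_bound)
    show "AE z in P. norm (exp (X z)) \<le> exp (l * (c f + 2 * r))"
      using AE_unit_sample
    proof eventually_elim
      case (elim z)
      then show ?case using loss_diff_le[OF elim, of f h] ball[OF f(1)] l
        by (auto simp: X_def intro!: mult_left_mono)
    qed
  qed measurable
  have "exp (expectation X) \<le> expectation (\<lambda>z. exp (X z))"
    by (rule jensens_inequality[where I = UNIV]) (auto simp: iX ie exp_convex)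
  then have "ennreal (exp (l * (MAX f\<in>F. c f + 2 * (risk f - risk h)))) \<le> ennreal (expectation (\<lambda>z. exp (X z)))"
    unfolding f(2) EX[symmetric] by (intro ennreal_leI)
  also have "\<dots> = (\<integral>\<^sup>+z. ennreal (exp (X z)) \<partial>P)"
    using ie by (simp add: nn_integral_eq_integral)
  also have "\<dots> \<le> (\<integral>\<^sup>+z. ennreal (exp (l * (MAX f\<in>F. c f + 2 * excess f z))) \<partial>P)"
    unfolding X_def using F_Max_ge[OF f(1)] l
    by (intro nn_integral_mono ennreal_leI) (auto intro!: mult_left_mono)
  finally show ?thesis .
qed

text \<open>\<open>c + (a - b)\<close> is the midpoint of \<open>c - 2 * b\<close> and
  \<open>c + 2 * a\<close>, so convexity of \<open>exp\<close> separates the population part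
  \<open>a\<close> from the sample part \<open>b\<close>, at the price of doubling both.\<close>

lemma exp_Max_le_sign_average:
  fixes a b c :: "(nat \<Rightarrow> real) \<Rightarrow> real"
  shows "exp (l * (MAX f\<in>F. c f + (a f - b f)))
    \<le> exp (l * (MAX f\<in>F. c f - 2 * b f)) / 2 + exp (l * (MAX f\<in>F. c f + 2 * a f)) / 2"
proof -
  obtain f where f: "f \<in> F" "(MAX f\<in>F. c f + (a f - b f)) = c f + (a f - b f)" by (rule F_Max_attained)
  define A where "A = l * (c f - 2 * b f)"
  define A' where "A' = l * (c f + 2 * a f)"
  have mid: "l * (c f + (a f - b f)) = (1 - 1/2) * A + (1/2) * A'"
    by (simp add: A_def A'_def field_simps)
  have "exp (l * (c f + (a f - b f))) \<le> exp A / 2 + exp A' / 2"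
    unfolding mid using convex_onD[OF exp_convex, of "1/2" A A'] by simp
  moreover have "A \<le> l * (MAX f\<in>F. c f - 2 * b f)" "A' \<le> l * (MAX f\<in>F. c f + 2 * a f)"
    unfolding A_def A'_def using F_Max_ge[OF f(1)] l by (auto intro!: mult_left_mono)
  moreover from this have "exp A \<le> exp (l * (MAX f\<in>F. c f - 2 * b f))" "exp A' \<le> exp (l * (MAX f\<in>F. c f + 2 * a f))"
    by simp_all
  ultimately show ?thesis unfolding f(2) by linarith
qed

text \<open>A centred term is traded for a linear term with random sign. Once the excess loss
  appears with both signs on the same sample, it can be contracted to the margin of
  \<open>f - h\<close>.\<close>

lemma one_sample_contraction:
  fixes c :: "(nat \<Rightarrow> real) \<Rightarrow> real"
  shows "(\<integral>\<^sup>+z. ennreal (exp (l * (MAX f\<in>F. c f + ((risk f - risk h) - excess f z)))) \<partial>P)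
    \<le> (\<integral>\<^sup>+z. ennreal (exp (l * (MAX f\<in>F. c f + 2 * margin (\<lambda>i. f i - h i) z)) / 2
          + exp (l * (MAX f\<in>F. c f - 2 * margin (\<lambda>i. f i - h i) z)) / 2) \<partial>P)"
    (is "?lhs \<le> ?rhs")
proof -
  note [measurable] = borel_measurable_Max[OF F(1)]
  let ?K = "exp (l * (MAX f\<in>F. c f + 2 * (risk f - risk h)))"
  have "?lhs \<le> (\<integral>\<^sup>+z. ennreal (exp (l * (MAX f\<in>F. c f - 2 * excess f z)) / 2) + ennreal (?K / 2) \<partial>P)"
  proof (rule nn_integral_mono)
    fix z
    have "ennreal (exp (l * (MAX f\<in>F. c f + ((risk f - risk h) - excess f z))))
        \<le> ennreal (exp (l * (MAX f\<in>F. c f - 2 * excess f z)) / 2 + ?K / 2)"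
      by (intro ennreal_leI exp_Max_le_sign_average)
    also have "\<dots> = ennreal (exp (l * (MAX f\<in>F. c f - 2 * excess f z)) / 2) + ennreal (?K / 2)"
      by (rule ennreal_plus) auto
    finally show "ennreal (exp (l * (MAX f\<in>F. c f + ((risk f - risk h) - excess f z))))
        \<le> ennreal (exp (l * (MAX f\<in>F. c f - 2 * excess f z)) / 2) + ennreal (?K / 2)" .
  qed
  also have "\<dots> = (\<integral>\<^sup>+z. ennreal (exp (l * (MAX f\<in>F. c f - 2 * excess f z)) / 2) \<partial>P) + ennreal (?K / 2)"
    by (subst nn_integral_add) (auto simp: emeasure_space_1)
  also have "ennreal (?K / 2) = ennreal (1/2) * ennreal ?K"
    by (rule ennreal_divide_two) simp
  \<comment> \<open>Jensen replaces the population excess by a sample excess of positive sign, the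
    partner of the negative one.\<close>
  also have "\<dots> \<le> ennreal (1/2) * (\<integral>\<^sup>+z. ennreal (exp (l * (MAX f\<in>F. c f + 2 * excess f z))) \<partial>P)"
    by (intro mult_left_mono exp_Max_expectation_le) auto
  also have "\<dots> = (\<integral>\<^sup>+z. ennreal (exp (l * (MAX f\<in>F. c f + 2 * excess f z)) / 2) \<partial>P)"
    unfolding ennreal_divide_two[OF exp_ge_zero] by (rule nn_integral_cmult[symmetric]) measurable
  also have "(\<integral>\<^sup>+z. ennreal (exp (l * (MAX f\<in>F. c f - 2 * excess f z)) / 2) \<partial>P) + \<dots>
     = (\<integral>\<^sup>+z. ennreal (exp (l * (MAX f\<in>F. c f + 2 * excess f z)) / 2
              + exp (l * (MAX f\<in>F. c f - 2 * excess f z)) / 2) \<partial>P)"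
    by (subst nn_integral_add[symmetric]) (auto simp: add.commute simp flip: ennreal_plus)
  also have "\<dots> \<le> ?rhs"
  proof (intro nn_integral_mono_AE, use AE_unit_sample in eventually_elim)
    case (elim z)
    have "exp (l * (MAX f\<in>F. c f + 2 * excess f z)) + exp (l * (MAX f\<in>F. c f - 2 * excess f z))
      \<le> exp (l * (MAX f\<in>F. c f + 2 * margin (\<lambda>i. f i - h i) z))
        + exp (l * (MAX f\<in>F. c f - 2 * margin (\<lambda>i. f i - h i) z))"
    \<comment> \<open>At a fixed sample the excess loss is a 1-Lipschitz function of the margin of
      \<open>f - h\<close> that vanishes at margin zero, which supplies both hypotheses of the
      contraction.\<close>
    proof (rule exp_Max_contraction[OF F l])
      fix f g
      show "\<bar>2 * excess f z - 2 * excess g z\<bar>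
          \<le> \<bar>2 * margin (\<lambda>i. f i - h i) z - 2 * margin (\<lambda>i. g i - h i) z\<bar>"
        using Lipschitz[of "margin f z" "margin g z"] by (simp add: margin_diff[symmetric])
      show "\<bar>2 * excess f z\<bar> \<le> \<bar>2 * margin (\<lambda>i. f i - h i) z\<bar>"
        using Lipschitz[of "margin f z" "margin h z"] by (simp add: margin_diff[symmetric])
    qed
    then show ?case by (intro ennreal_leI) simp
  qed
  finally show ?thesis by (simp add: add_right_mono)
qed

end

text \<open>Unnormalized, relative to \<open>h\<close>, and one-sided: what has to be controlled is
  how far the sample underestimates the population excess.\<close>

definition deviation :: "nat \<Rightarrow> (nat \<Rightarrow> real) \<Rightarrow> (nat \<Rightarrow> (nat \<Rightarrow> real) \<times> real) \<Rightarrow> (nat \<Rightarrow> real) \<Rightarrow> real" where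
  "deviation n h D f = (\<Sum>j<n. (risk f - risk h) - (L (margin f (D j)) - L (margin h (D j))))"

lemma deviation_Suc:
  "deviation (Suc n) h (D(n := z)) f
     = deviation n h D f + ((risk f - risk h) - (L (margin f z) - L (margin h z)))"
  by (simp add: deviation_def)

lemma measurable_deviation [measurable]:
  "(\<lambda>D. deviation n h D f) \<in> borel_measurable (PiM {..<n} (\<lambda>_. P))"
  unfolding deviation_def by measurable

text \<open>Induction on the number of samples with \<open>v\<close> arbitrary: each removed sample
  becomes a signed shift of \<open>v\<close> by label times input, so the statement reproduces
  itself. The bound is independent of the size of \<open>F\<close>.\<close>

lemma exp_Max_deviation_le:
  assumes F: "finite F" "F \<noteq> {}" and l: "0 \<le> l" and r: "0 \<le> r"
    and ball: "\<And>f. f \<in> F \<Longrightarrow> vnorm d (\<lambda>i. f i - h i) \<le> r"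
  shows "(\<integral>\<^sup>+D. ennreal (exp (l * (MAX f\<in>F. 2 * vinner d (\<lambda>i. f i - h i) v + deviation n h D f)))
            \<partial>PiM {..<n} (\<lambda>_. P))
     \<le> ennreal (2 * cosh (2 * l * r * vnorm d v) * cosh (2 * l * r) ^ n)"
proof (induction n arbitrary: v)
  case 0
  have "vinner d (\<lambda>i. f i - h i) v \<le> r * vnorm d v" if "f \<in> F" for f
    using vinner_le[of d "\<lambda>i. f i - h i" v] mult_right_mono[OF ball[OF that], of "vnorm d v"] by simp
  then have "(MAX f\<in>F. 2 * vinner d (\<lambda>i. f i - h i) v) \<le> 2 * (r * vnorm d v)"
    using F by (subst Max_le_iff) auto
  from mult_left_mono[OF this l]
  have "exp (l * (MAX f\<in>F. 2 * vinner d (\<lambda>i. f i - h i) v)) \<le> exp (2 * l * r * vnorm d v)"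
    by (simp add: mult_ac)
  \<comment> \<open>The factor 2 is paid once, here; from now on the bound is a \<open>cosh\<close>
    of the norm of \<open>v\<close>, the form that survives signed shifts.\<close>
  also have "\<dots> \<le> 2 * cosh (2 * l * r * vnorm d v)"
    by (simp add: cosh_field_def)
  finally show ?case
    by (simp add: PiM_empty nn_integral_count_space_finite deviation_def ennreal_leI)
next
  case (Suc n)
  interpret PP: product_sigma_finite "\<lambda>_::nat. P" by standard
  interpret Pn: prob_space "PiM {..<n} (\<lambda>_. P)" by (intro prob_space_PiM prob_space_axioms)
  interpret pair_sigma_finite P "PiM {..<n} (\<lambda>_. P)" by standard
  note [measurable] = borel_measurable_Max[OF F(1)]
  let ?Pn = "PiM {..<n} (\<lambda>_. P)"
  let ?w = "\<lambda>f. \<lambda>i. f i - h i :: real"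
  let ?A = "\<lambda>v D. exp (l * (MAX f\<in>F. 2 * vinner d (?w f) v + deviation n h D f))"
  define zp where "zp z = (\<lambda>i. v i + snd z * fst z i)" for z :: "(nat \<Rightarrow> real) \<times> real"
  define zm where "zm z = (\<lambda>i. v i - snd z * fst z i)" for z :: "(nat \<Rightarrow> real) \<times> real"
  have zp: "2 * vinner d w (zp z) = 2 * vinner d w v + 2 * margin w z" for w z
    unfolding zp_def margin_def
    by (simp add: vinner_commute[of d w] vinner_add_left vinner_scale_left distrib_left)
  have zm: "2 * vinner d w (zm z) = 2 * vinner d w v - 2 * margin w z" for w z
    unfolding zm_def margin_def
    by (simp add: vinner_commute[of d w] vinner_diff_left vinner_scale_left right_diff_distrib)
  have "(\<integral>\<^sup>+D. ennreal (exp (l * (MAX f\<in>F. 2 * vinner d (?w f) v + deviation (Suc n) h D f)))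
            \<partial>PiM {..<Suc n} (\<lambda>_. P))
    = (\<integral>\<^sup>+D. (\<integral>\<^sup>+z. ennreal (exp (l * (MAX f\<in>F. (2 * vinner d (?w f) v + deviation n h D f) +
          ((risk f - risk h) - (L (margin f z) - L (margin h z)))))) \<partial>P) \<partial>?Pn)"
    unfolding lessThan_Suc
    by (subst PP.product_nn_integral_insert)
      (auto simp: deviation_Suc add.assoc lessThan_Suc[symmetric])
  also have "\<dots> \<le> (\<integral>\<^sup>+D. (\<integral>\<^sup>+z. ennreal (?A (zp z) D / 2 + ?A (zm z) D / 2) \<partial>P) \<partial>?Pn)"
  proof (rule nn_integral_mono)
    fix D
    show "(\<integral>\<^sup>+z. ennreal (exp (l * (MAX f\<in>F. (2 * vinner d (?w f) v + deviation n h D f) +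
          ((risk f - risk h) - (L (margin f z) - L (margin h z)))))) \<partial>P)
      \<le> (\<integral>\<^sup>+z. ennreal (?A (zp z) D / 2 + ?A (zm z) D / 2) \<partial>P)"
      using one_sample_contraction[OF F l r ball, of "\<lambda>f. 2 * vinner d (?w f) v + deviation n h D f"]
      unfolding zp zm by (simp add: algebra_simps)
  qed
  \<comment> \<open>Exchanging the integrals fixes the removed sample, so that the induction
    hypothesis applies at the shifted vectors \<open>zp z\<close> and \<open>zm z\<close>.\<close>
  also have "\<dots> = (\<integral>\<^sup>+z. (\<integral>\<^sup>+D. ennreal (?A (zp z) D / 2 + ?A (zm z) D / 2) \<partial>?Pn) \<partial>P)"
    unfolding zp zm by (rule Fubini') measurable
  also have "\<dots> \<le> (\<integral>\<^sup>+z. ennreal (2 * cosh (2 * l * r * vnorm d v) * cosh (2 * l * r) ^ Suc n) \<partial>P)"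
  proof (intro nn_integral_mono_AE, use AE_unit_sample in eventually_elim)
    case (elim z)
    define C where "C = cosh (2 * l * r) ^ n"
    have C: "0 \<le> C" unfolding C_def by simp
    have nz: "vnorm d (\<lambda>i. snd z * fst z i) \<le> 1"
      using elim by (auto simp: vnorm_scale unit_sample_def)
    have half: "(\<integral>\<^sup>+D. ennreal (?A v' D / 2) \<partial>?Pn) \<le> ennreal (cosh (2 * l * r * vnorm d v') * C)" for v'
    proof -
      have "(\<integral>\<^sup>+D. ennreal (?A v' D / 2) \<partial>?Pn) = ennreal (1/2) * (\<integral>\<^sup>+D. ennreal (?A v' D) \<partial>?Pn)"
        unfolding ennreal_divide_two[OF exp_ge_zero] by (rule nn_integral_cmult) measurable
      also have "\<dots> \<le> ennreal (1/2) * ennreal (2 * cosh (2 * l * r * vnorm d v') * C)"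
        unfolding C_def by (intro mult_left_mono Suc.IH) auto
      also have "\<dots> = ennreal (cosh (2 * l * r * vnorm d v') * C)"
        using C by (subst ennreal_mult[symmetric]) auto
      finally show ?thesis .
    qed
    have "(\<integral>\<^sup>+D. ennreal (?A (zp z) D / 2 + ?A (zm z) D / 2) \<partial>?Pn)
      = (\<integral>\<^sup>+D. ennreal (?A (zp z) D / 2) \<partial>?Pn) + (\<integral>\<^sup>+D. ennreal (?A (zm z) D / 2) \<partial>?Pn)"
      by (subst nn_integral_add[symmetric]) (auto simp flip: ennreal_plus)
    also have "\<dots> \<le> ennreal (cosh (2 * l * r * vnorm d (zp z)) * C) + ennreal (cosh (2 * l * r * vnorm d (zm z)) * C)"
      by (intro add_mono half)
    also have "\<dots> = ennreal ((cosh (2 * l * r * vnorm d (zp z)) + cosh (2 * l * r * vnorm d (zm z))) * C)"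
      using C by (simp add: distrib_right)
    also have "\<dots> \<le> ennreal (2 * cosh (2 * l * r * vnorm d v) * cosh (2 * l * r) * C)"
    proof (intro ennreal_leI mult_right_mono C)
      \<comment> \<open>The two shifts recombine into one further factor, since the shift has norm
        at most one.\<close>
      have "cosh (2 * l * r * vnorm d (zp z)) + cosh (2 * l * r * vnorm d (zm z))
         \<le> 2 * cosh (2 * l * r * vnorm d v) * cosh (2 * l * r * vnorm d (\<lambda>i. snd z * fst z i))"
        unfolding zp_def zm_def by (rule cosh_vnorm_add_le)
      also have "\<dots> \<le> 2 * cosh (2 * l * r * vnorm d v) * cosh (2 * l * r)"
        using l r nz mult_left_mono[OF nz, of "2 * l * r"]
        by (intro mult_left_mono) (auto simp: cosh_real_nonneg_le_iff)
      finally show "cosh (2 * l * r * vnorm d (zp z)) + cosh (2 * l * r * vnorm d (zm z))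
         \<le> 2 * cosh (2 * l * r * vnorm d v) * cosh (2 * l * r)" .
    qed
    finally show ?case by (simp add: C_def mult_ac)
  qed
  also have "\<dots> = ennreal (2 * cosh (2 * l * r * vnorm d v) * cosh (2 * l * r) ^ Suc n)"
    by (simp add: emeasure_space_1)
  finally show ?case .
qed

text \<open>Chernoff bound from the moment estimate at \<open>v = 0\<close>, with
  \<open>cosh\<close> replaced by its Gaussian majorant.\<close>

lemma Max_deviation_tail:
  assumes F: "finite F" "F \<noteq> {}" and r: "0 < r"
    and ball: "\<And>f. f \<in> F \<Longrightarrow> vnorm d (\<lambda>i. f i - h i) \<le> r"
    and B: "0 < B" and t: "0 < t"
  shows "measure (PiM {..<B} (\<lambda>_. P))
      {D \<in> space (PiM {..<B} (\<lambda>_. P)). t \<le> (MAX f\<in>F. deviation B h D f)}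
     \<le> 2 * exp (- (t\<^sup>2 / (8 * r\<^sup>2 * real B)))"
proof -
  let ?PB = "PiM {..<B} (\<lambda>_. P)"
  interpret PB: prob_space ?PB by (intro prob_space_PiM prob_space_axioms)
  note [measurable] = borel_measurable_Max[OF F(1)]
  \<comment> \<open>This value minimizes the exponent
    \<open>- l * t + real B * (2 * l\<^sup>2 * r\<^sup>2)\<close>.\<close>
  define l where "l = t / (4 * r\<^sup>2 * real B)"
  have l: "0 < l" using t r B by (simp add: l_def)
  let ?M = "\<lambda>D. MAX f\<in>F. deviation B h D f"
  have "emeasure ?PB {D \<in> space ?PB. t \<le> ?M D}
    = emeasure ?PB {D \<in> space ?PB. 1 \<le> ennreal (exp (- l * t)) * ennreal (exp (l * ?M D))}"
  proof (intro arg_cong2[where f = emeasure] Collect_cong conj_cong refl)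
    fix D
    have "1 \<le> ennreal (exp (- l * t)) * ennreal (exp (l * ?M D)) \<longleftrightarrow> ennreal 1 \<le> ennreal (exp (l * (?M D - t)))"
      by (simp add: ennreal_mult[symmetric] exp_add[symmetric] right_diff_distrib)
    also have "\<dots> \<longleftrightarrow> t \<le> ?M D"
      using l by (subst ennreal_le_iff) (auto simp: zero_le_mult_iff)
    finally show "t \<le> ?M D \<longleftrightarrow> 1 \<le> ennreal (exp (- l * t)) * ennreal (exp (l * ?M D))" by simp
  qed
  also have "\<dots> \<le> ennreal (exp (- l * t)) * (\<integral>\<^sup>+D. ennreal (exp (l * ?M D)) * indicator (space ?PB) D \<partial>?PB)"
    using nn_integral_Markov_inequality[of "\<lambda>D. ennreal (exp (l * ?M D))" "space ?PB" ?PB "ennreal (exp (- l * t))"]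
    by simp
  also have "(\<integral>\<^sup>+D. ennreal (exp (l * ?M D)) * indicator (space ?PB) D \<partial>?PB) = (\<integral>\<^sup>+D. ennreal (exp (l * ?M D)) \<partial>?PB)"
    by (intro nn_integral_cong) auto
  also have "\<dots> \<le> ennreal (2 * cosh (2 * l * r) ^ B)"
    using exp_Max_deviation_le[OF F _ _ ball, where v = "\<lambda>_. 0" and l = l and n = B] l r
    by (simp add: vinner_def vnorm_def)
  also have "\<dots> \<le> ennreal (2 * exp (2 * l\<^sup>2 * r\<^sup>2) ^ B)"
    using cosh_le_exp_half_square[of "2 * l * r"]
    by (intro ennreal_leI mult_left_mono power_mono) (auto simp: power_mult_distrib mult.assoc)
  also have "ennreal (exp (- l * t)) * \<dots> = ennreal (2 * exp (- (t\<^sup>2 / (8 * r\<^sup>2 * real B))))"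
  proof -
    have "exp (- l * t) * (2 * exp (2 * l\<^sup>2 * r\<^sup>2) ^ B) = 2 * exp (- l * t + real B * (2 * l\<^sup>2 * r\<^sup>2))"
      unfolding exp_add exp_of_nat_mult by simp
    also have "- l * t + real B * (2 * l\<^sup>2 * r\<^sup>2) = - (t\<^sup>2 / (8 * r\<^sup>2 * real B))"
      using r B by (simp add: l_def field_simps power2_eq_square)
    finally show ?thesis by (subst ennreal_mult[symmetric]) auto
  qed
  finally show ?thesis by (simp add: PB.emeasure_eq_measure mult_left_mono)
qed

text \<open>Population risk and sample loss are both 1-Lipschitz in \<open>f\<close>, whence a
  factor 2 per sample. This passes from a net to the whole ball.\<close>

lemma deviation_diff_le:
  assumes "\<And>j. j < n \<Longrightarrow> unit_sample (D j)"
  shows "deviation n h D f - deviation n h D g \<le> 2 * real n * vnorm d (\<lambda>i. f i - g i)"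
proof -
  have "deviation n h D f - deviation n h D g
     = (\<Sum>j<n. (risk f - risk g) - (L (margin f (D j)) - L (margin g (D j))))"
    unfolding deviation_def sum_subtractf[symmetric] by (intro sum.cong) auto
  also have "\<dots> \<le> (\<Sum>j<n. 2 * vnorm d (\<lambda>i. f i - g i))"
  proof (intro sum_mono)
    fix j assume "j \<in> {..<n}"
    then have "\<bar>L (margin f (D j)) - L (margin g (D j))\<bar> \<le> vnorm d (\<lambda>i. f i - g i)"
      using assms by (intro loss_diff_le) auto
    then show "(risk f - risk g) - (L (margin f (D j)) - L (margin g (D j))) \<le> 2 * vnorm d (\<lambda>i. f i - g i)"
      using risk_diff_le[of f g] by linarith
  qed
  finally show ?thesis by simp
qed

text \<open>The good event requires every sample to be a unit sample and the maximum over the net to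
  stay below \<open>4 * r * q\<close>. The mesh of the net adds one more \<open>r * q\<close>, which
  makes the constant 5.\<close>

lemma uniform_deviation:
  assumes r: "0 < r" and B: "0 < B" and \<delta>: "0 < \<delta>" "\<delta> < 1/2"
  obtains E where "E \<in> sets (PiM {..<B} (\<lambda>_. P))" "1 - \<delta> \<le> measure (PiM {..<B} (\<lambda>_. P)) E"
    "\<And>D f. D \<in> E \<Longrightarrow> vnorm d (\<lambda>i. f i - h i) \<le> r \<Longrightarrow>
        deviation B h D f \<le> 5 * r * sqrt (real B * ln (1 / \<delta>))"
proof -
  let ?PB = "PiM {..<B} (\<lambda>_. P)"
  interpret PB: prob_space ?PB by (intro prob_space_PiM prob_space_axioms)
  define q where "q = sqrt (real B * ln (1 / \<delta>))"
  have ln: "0 < ln (1 / \<delta>)" using \<delta> by (intro ln_gt_zero) auto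
  have q: "0 < q" "q\<^sup>2 = real B * ln (1 / \<delta>)" using B ln by (auto simp: q_def)
  have "0 < r * q / (2 * real B)" using r q B by simp
  then obtain F where F: "finite F" "F \<noteq> {}" "\<And>f. f \<in> F \<Longrightarrow> vnorm d (\<lambda>i. f i - h i) \<le> r"
    and net: "\<And>f. vnorm d (\<lambda>i. f i - h i) \<le> r \<Longrightarrow> \<exists>g\<in>F. vnorm d (\<lambda>i. f i - g i) \<le> r * q / (2 * real B)"
    using finite_ball_net[of r "r * q / (2 * real B)" d h] r by auto
  note [measurable] = borel_measurable_Max[OF F(1)]
  define T where "T = {D \<in> space ?PB. 4 * r * q \<le> (MAX f\<in>F. deviation B h D f)}"
  have T [measurable]: "T \<in> sets ?PB" unfolding T_def by measurable
  \<comment> \<open>At level \<open>4 * r * q\<close> the tail bound equals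
    \<open>2 * \<delta> * \<delta>\<close>, which is at most \<open>\<delta>\<close> because
    \<open>\<delta> < 1/2\<close>.\<close>
  have "- ((4 * r * q)\<^sup>2 / (8 * r\<^sup>2 * real B)) = - (2 * ln (1 / \<delta>))"
    using r B by (simp add: power_mult_distrib q field_simps)
  also have "\<dots> = 2 * ln \<delta>" using \<delta> by (simp add: ln_div)
  finally have ex: "2 * exp (- ((4 * r * q)\<^sup>2 / (8 * r\<^sup>2 * real B))) = 2 * \<delta> * \<delta>"
    using \<delta> by (simp add: exp_double power2_eq_square)
  have "measure ?PB T \<le> 2 * \<delta> * \<delta>"
    unfolding T_def ex[symmetric] using q r by (intro Max_deviation_tail F B) auto
  also have "\<dots> \<le> 1 * \<delta>" using \<delta> by (intro mult_right_mono) auto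
  finally have mT: "measure ?PB T \<le> \<delta>" by simp
  define U where "U = {D \<in> space ?PB. \<forall>j\<in>{..<B}. unit_sample (D j)}"
  have U [measurable]: "U \<in> sets ?PB" unfolding U_def by measurable
  have "AE D in ?PB. \<forall>j\<in>{..<B}. unit_sample (D j)"
    by (intro eventually_ball_finite ballI AE_PiM_component prob_space_axioms AE_unit_sample) auto
  then have "measure ?PB U = 1" unfolding U_def by (subst PB.prob_Collect_eq_1) measurable
  then have "measure ?PB (U - T) = 1 - measure ?PB (U \<inter> T)"
    by (simp add: PB.finite_measure_Diff')
  moreover have "measure ?PB (U \<inter> T) \<le> measure ?PB T" by (intro PB.finite_measure_mono) auto
  ultimately have "1 - \<delta> \<le> measure ?PB (U - T)" using mT by linarith
  moreover have "deviation B h D f \<le> 5 * r * q" if D: "D \<in> U - T" and f: "vnorm d (\<lambda>i. f i - h i) \<le> r" for D f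
  proof -
    obtain g where g: "g \<in> F" "vnorm d (\<lambda>i. f i - g i) \<le> r * q / (2 * real B)" using net[OF f] by blast
    have "deviation B h D f - deviation B h D g \<le> 2 * real B * vnorm d (\<lambda>i. f i - g i)"
      using D by (intro deviation_diff_le) (auto simp: U_def)
    also have "\<dots> \<le> 2 * real B * (r * q / (2 * real B))" using g by (intro mult_left_mono) auto
    also have "\<dots> = r * q" using B by simp
    finally have "deviation B h D f \<le> deviation B h D g + r * q" by simp
    moreover have "deviation B h D g \<le> (MAX f\<in>F. deviation B h D f)" using F g by (intro Max_ge) auto
    moreover have "(MAX f\<in>F. deviation B h D f) < 4 * r * q" using D by (auto simp: U_def T_def)
    ultimately show ?thesis by linarith
  qed
  ultimately show ?thesis unfolding q_def by (intro that[of "U - T"]) auto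
qed

end

section \<open>The perturbed regularized minimizer\<close>

lemma vnorm_sq_convex_combination:
  "(vnorm d (\<lambda>i. t * f i + (1 - t) * g i))\<^sup>2
     = t * (vnorm d f)\<^sup>2 + (1 - t) * (vnorm d g)\<^sup>2 - t * (1 - t) * (vnorm d (\<lambda>i. f i - g i))\<^sup>2"
  unfolding vnorm_sq sum_distrib_left sum.distrib[symmetric] sum_subtractf[symmetric]
  by (intro sum.cong) (auto simp: power2_eq_square algebra_simps)

text \<open>The squared norm has an exact quadratic convexity defect, so the whole modulus comes
  from the regularizer and \<open>H\<close> need only be convex.\<close>

lemma strongly_convex_add_quadratic:
  assumes "\<And>f g t. 0 \<le> t \<Longrightarrow> t \<le> 1 \<Longrightarrow> H (\<lambda>i. t * f i + (1 - t) * g i) \<le> t * H f + (1 - t) * H g"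
  shows "strongly_convex d \<rho> (\<lambda>f. H f + \<rho> / 2 * (vnorm d f)\<^sup>2)"
  unfolding strongly_convex_def
proof (intro allI impI)
  fix f g :: "nat \<Rightarrow> real" and t :: real assume t: "0 \<le> t \<and> t \<le> 1"
  have rearrange: "x + c * (t * a + (1 - t) * b - t * (1 - t) * e) \<le> t * (y + c * a) + (1 - t) * (z + c * b) - c * t * (1 - t) * e"
    if "x \<le> t * y + (1 - t) * z" for x y z a b c e :: real
    using that by (simp add: algebra_simps)
  from assms[of t f g] t show "H (\<lambda>i. t * f i + (1 - t) * g i) + \<rho> / 2 * (vnorm d (\<lambda>i. t * f i + (1 - t) * g i))\<^sup>2
    \<le> t * (H f + \<rho> / 2 * (vnorm d f)\<^sup>2) + (1 - t) * (H g + \<rho> / 2 * (vnorm d g)\<^sup>2)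
      - \<rho> / 2 * t * (1 - t) * (vnorm d (\<lambda>i. f i - g i))\<^sup>2"
    unfolding vnorm_sq_convex_combination by (intro rearrange) simp
qed

text \<open>Completing the square: a loss that decreases at most linearly cannot outrun the
  regularizer, so both objectives are bounded below.\<close>

lemma quadratic_lower_bound:
  fixes K s \<rho> :: real
  assumes "0 < \<rho>" shows "- (K\<^sup>2 / (2 * \<rho>)) \<le> \<rho> / 2 * s\<^sup>2 - K * s"
proof -
  have "0 \<le> (\<rho> * s - K)\<^sup>2 / (2 * \<rho>)" using assms by simp
  also have "\<dots> = \<rho> / 2 * s\<^sup>2 - K * s + K\<^sup>2 / (2 * \<rho>)"
    using assms by (simp add: power2_diff field_simps power2_eq_square)
  finally show ?thesis by simp
qed

locale convex_margin_loss = margin_loss +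
  fixes CR \<rho> :: real and B :: nat
  assumes convex: "\<And>t a b. 0 \<le> t \<Longrightarrow> t \<le> 1 \<Longrightarrow> L (t * a + (1 - t) * b) \<le> t * L a + (1 - t) * L b"
    and CR: "0 < CR" and \<rho>: "0 < \<rho>" and B: "0 < B"
begin

definition population_objective :: "(nat \<Rightarrow> real) \<Rightarrow> real" where
  "population_objective f = CR * risk f + \<rho> / 2 * (vnorm d f)\<^sup>2"

definition noisy_objective ::
  "(nat \<Rightarrow> (nat \<Rightarrow> real) \<times> real) \<Rightarrow> (nat \<Rightarrow> real) \<Rightarrow> (nat \<Rightarrow> real) \<Rightarrow> real" where
  "noisy_objective D e f = Zp CR L \<rho> d B D f + CR / real B * vinner d e f"

lemma noisy_objective_eq:
  "noisy_objective D e f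
     = CR / real B * ((\<Sum>j<B. L (margin f (D j))) + vinner d e f) + \<rho> / 2 * (vnorm d f)\<^sup>2"
  by (simp add: noisy_objective_def Zp_def Rreg_def margin_def distrib_left)

lemma margin_convex_combination:
  "margin (\<lambda>i. t * f i + (1 - t) * g i) z = t * margin f z + (1 - t) * margin g z"
  by (simp add: margin_def vinner_add_left vinner_scale_left distrib_left mult.left_commute)

lemma loss_convex:
  "0 \<le> t \<Longrightarrow> t \<le> 1 \<Longrightarrow>
    L (margin (\<lambda>i. t * f i + (1 - t) * g i) z) \<le> t * L (margin f z) + (1 - t) * L (margin g z)"
  unfolding margin_convex_combination by (rule convex)

lemma strongly_convex_population_objective: "strongly_convex d \<rho> population_objective"
  unfolding population_objective_def
proof (rule strongly_convex_add_quadratic)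
  fix f g :: "nat \<Rightarrow> real" and t :: real assume t: "0 \<le> t" "t \<le> 1"
  have "risk (\<lambda>i. t * f i + (1 - t) * g i) \<le> (\<integral>z. t * L (margin f z) + (1 - t) * L (margin g z) \<partial>P)"
    unfolding risk_def using t by (intro integral_mono loss_convex) auto
  also have "\<dots> = t * risk f + (1 - t) * risk g" by (simp add: risk_def)
  finally have "CR * risk (\<lambda>i. t * f i + (1 - t) * g i) \<le> CR * (t * risk f + (1 - t) * risk g)"
    using CR by (intro mult_left_mono) auto
  then show "CR * risk (\<lambda>i. t * f i + (1 - t) * g i) \<le> t * (CR * risk f) + (1 - t) * (CR * risk g)"
    by (simp add: algebra_simps)
qed

lemma strongly_convex_noisy_objective: "strongly_convex d \<rho> (noisy_objective D e)"
  unfolding noisy_objective_eq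
proof (rule strongly_convex_add_quadratic)
  fix f g :: "nat \<Rightarrow> real" and t :: real assume t: "0 \<le> t" "t \<le> 1"
  let ?h = "\<lambda>i. t * f i + (1 - t) * g i"
  have "(\<Sum>j<B. L (margin ?h (D j))) \<le> (\<Sum>j<B. t * L (margin f (D j)) + (1 - t) * L (margin g (D j)))"
    using t by (intro sum_mono loss_convex)
  also have "\<dots> = t * (\<Sum>j<B. L (margin f (D j))) + (1 - t) * (\<Sum>j<B. L (margin g (D j)))"
    by (simp add: sum.distrib sum_distrib_left)
  finally have "(\<Sum>j<B. L (margin ?h (D j))) + vinner d e ?h
     \<le> t * ((\<Sum>j<B. L (margin f (D j))) + vinner d e f) + (1 - t) * ((\<Sum>j<B. L (margin g (D j))) + vinner d e g)"
    by (simp add: vinner_commute[of d e] vinner_add_left vinner_scale_left distrib_left)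
  from mult_left_mono[OF this, of "CR / real B"] CR
  show "CR / real B * ((\<Sum>j<B. L (margin ?h (D j))) + vinner d e ?h)
     \<le> t * (CR / real B * ((\<Sum>j<B. L (margin f (D j))) + vinner d e f))
       + (1 - t) * (CR / real B * ((\<Sum>j<B. L (margin g (D j))) + vinner d e g))"
    by (simp add: distrib_left mult.left_commute)
qed

lemma coord_continuous_risk: "coord_continuous d risk"
  unfolding coord_continuous_def
proof (intro allI impI)
  fix X and f :: "nat \<Rightarrow> real" assume X: "\<forall>i<d. (\<lambda>n. X n i) \<longlonglongrightarrow> f i"
  have "(\<lambda>n. vnorm d (\<lambda>i. X n i - f i)) \<longlonglongrightarrow> vnorm d (\<lambda>i. f i - f i)"
    using X by (intro coord_continuousD[OF coord_continuous_vnorm] tendsto_intros) auto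
  then have "(\<lambda>n. vnorm d (\<lambda>i. X n i - f i)) \<longlonglongrightarrow> 0" by (simp add: vnorm_def)
  then have "(\<lambda>n. risk (X n) - risk f) \<longlonglongrightarrow> 0"
    by (rule Lim_null_comparison[rotated]) (auto intro!: always_eventually risk_diff_le)
  then show "(\<lambda>n. risk (X n)) \<longlonglongrightarrow> risk f" by (simp add: LIM_zero_iff)
qed

lemma coord_continuous_population_objective: "coord_continuous d population_objective"
  using coord_continuous_risk coord_continuous_vnorm[of d]
  unfolding coord_continuous_def population_objective_def by (auto intro!: tendsto_intros)

lemma coord_continuous_noisy_objective: "coord_continuous d (noisy_objective D e)"
  unfolding coord_continuous_def
proof (intro allI impI)
  fix X and f :: "nat \<Rightarrow> real" assume X: "\<forall>i<d. (\<lambda>n. X n i) \<longlonglongrightarrow> f i"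
  have v: "(\<lambda>n. vinner d x (X n)) \<longlonglongrightarrow> vinner d x f" for x
    using X coord_continuousD[OF coord_continuous_vinner, of d X f x] by (simp add: vinner_commute)
  have "(\<lambda>n. L (margin (X n) z)) \<longlonglongrightarrow> L (margin f z)" for z
    unfolding margin_def by (intro isCont_tendsto_compose[OF isCont_L] tendsto_mult_left)
      (use v[of "fst z"] in \<open>simp add: vinner_commute\<close>)
  then show "(\<lambda>n. noisy_objective D e (X n)) \<longlonglongrightarrow> noisy_objective D e f"
    unfolding noisy_objective_eq using X v
    by (intro tendsto_intros coord_continuousD[OF coord_continuous_vnorm]) auto
qed

lemma population_minimizer_exists: "\<exists>h. \<forall>g. population_objective h \<le> population_objective g"
proof (rule strongly_convex_min_exists[OF strongly_convex_population_objective \<rho> coord_continuous_population_objective])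
  fix f :: "nat \<Rightarrow> real"
  have "risk (\<lambda>_. 0) - vnorm d f \<le> risk f"
    using risk_diff_le[of f "\<lambda>_. 0"] by simp
  then have "CR * (risk (\<lambda>_. 0) - vnorm d f) \<le> CR * risk f" using CR by (intro mult_left_mono) auto
  with quadratic_lower_bound[OF \<rho>, of CR "vnorm d f"]
  show "CR * risk (\<lambda>_. 0) - CR\<^sup>2 / (2 * \<rho>) \<le> population_objective f"
    unfolding population_objective_def by (simp add: right_diff_distrib)
qed

text \<open>Established for every \<open>D\<close> and \<open>e\<close>, also outside the support of
  \<open>P\<close>; the slope \<open>K\<close> therefore collects the actual sizes of samples and
  noise.\<close>

lemma noisy_minimizer_exists: "\<exists>h. \<forall>g. noisy_objective D e h \<le> noisy_objective D e g"
proof (rule strongly_convex_min_exists[OF strongly_convex_noisy_objective \<rho> coord_continuous_noisy_objective])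
  fix f :: "nat \<Rightarrow> real"
  define K where "K = (\<Sum>j<B. \<bar>snd (D j)\<bar> * vnorm d (fst (D j))) + vnorm d e"
  have "(\<Sum>j<B. L 0 - \<bar>snd (D j)\<bar> * vnorm d (fst (D j)) * vnorm d f) \<le> (\<Sum>j<B. L (margin f (D j)))"
  proof (rule sum_mono)
    fix j
    have "\<bar>margin f (D j)\<bar> \<le> \<bar>snd (D j)\<bar> * (vnorm d f * vnorm d (fst (D j)))"
      unfolding margin_def abs_mult by (intro mult_left_mono vinner_le) auto
    then show "L 0 - \<bar>snd (D j)\<bar> * vnorm d (fst (D j)) * vnorm d f \<le> L (margin f (D j))"
      using Lipschitz[of "margin f (D j)" 0] by (simp add: mult_ac)
  qed
  moreover have "- (vnorm d e * vnorm d f) \<le> vinner d e f" using vinner_le[of d e f] by linarith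
  ultimately have "real B * L 0 - K * vnorm d f \<le> (\<Sum>j<B. L (margin f (D j))) + vinner d e f"
    by (simp add: K_def sum_subtractf sum_distrib_right distrib_right)
  then have "CR / real B * (real B * L 0 - K * vnorm d f) \<le> CR / real B * ((\<Sum>j<B. L (margin f (D j))) + vinner d e f)"
    using CR by (intro mult_left_mono) auto
  with quadratic_lower_bound[OF \<rho>, of "CR / real B * K" "vnorm d f"]
  show "CR / real B * (real B * L 0) - (CR / real B * K)\<^sup>2 / (2 * \<rho>) \<le> noisy_objective D e f"
    unfolding noisy_objective_eq right_diff_distrib by (simp add: mult.assoc)
qed

text \<open>The definite description is legitimate: the objective sees only coordinates below
  \<open>d\<close>, so restricting any minimizer gives one in \<open>Rd d\<close>, and quadratic
  growth makes it unique there.\<close>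

lemma fstar_minimizes: "noisy_objective D e (fstar CR L \<rho> d B D e) \<le> noisy_objective D e g"
proof -
  let ?G = "noisy_objective D e"
  let ?M = "\<lambda>f. f \<in> Rd d \<and> (\<forall>g\<in>Rd d. ?G f \<le> ?G g)"
  have restrict: "?G (restrict f {..<d}) = ?G f" for f
    by (rule coord_continuous_cong[OF coord_continuous_noisy_objective]) simp
  have Rd: "restrict f {..<d} \<in> Rd d" for f by (auto simp: Rd_def)
  have all: "?G f \<le> ?G g" if "?M f" for f g
    using that Rd[of g] restrict[of g] by metis
  obtain h where h: "\<And>g. ?G h \<le> ?G g" using noisy_minimizer_exists by blast
  have "\<exists>!f. ?M f"
  proof (rule ex1I)
    show "?M (restrict h {..<d})" by (intro conjI ballI Rd) (simp only: restrict h)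
    fix f assume f: "?M f"
    have "\<rho> / 4 * (vnorm d (\<lambda>i. f i - restrict h {..<d} i))\<^sup>2 \<le> ?G f - ?G (restrict h {..<d})"
      by (rule strongly_convex_min_growth[OF strongly_convex_noisy_objective]) (simp only: restrict h)
    also have "\<dots> \<le> 0" using all[OF f] by simp
    finally have "vnorm d (\<lambda>i. f i - restrict h {..<d} i) = 0"
      using \<rho> by (simp add: mult_le_0_iff)
    then have "f i = restrict h {..<d} i" if "i < d" for i
      using abs_coord_le_vnorm[OF that, of "\<lambda>i. f i - restrict h {..<d} i"] by simp
    then show "f = restrict h {..<d}"
      using f by (intro extensionalityI[of _ "{..<d}"]) (auto simp: Rd_def PiE_def)
  qed
  from theI'[OF this] show ?thesis
    unfolding fstar_def noisy_objective_def[symmetric] by (rule all)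
qed

text \<open>The regularizer cancels, and the two gaps differ by \<open>CR / real B\<close> times the
  deviation minus the inner product of \<open>e\<close> with \<open>f - h\<close>. Both are linear
  in the radius.\<close>

lemma objective_gap_transfer:
  assumes f: "vnorm d (\<lambda>i. f i - h i) \<le> r" and e: "vnorm d e \<le> T"
    and dev: "deviation B h D f \<le> r * \<kappa>"
  shows "population_objective f - population_objective h
     \<le> noisy_objective D e f - noisy_objective D e h + r * (CR / real B * (\<kappa> + T))"
proof -
  define c where "c = CR / real B"
  have "deviation B h D f
     = real B * (risk f - risk h) - ((\<Sum>j<B. L (margin f (D j))) - (\<Sum>j<B. L (margin h (D j))))"
    by (simp add: deviation_def sum_subtractf)
  then have "CR * (risk f - risk h)
     = CR / real B * ((\<Sum>j<B. L (margin f (D j))) - (\<Sum>j<B. L (margin h (D j)))) + CR / real B * deviation B h D f"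
    using B by (simp add: right_diff_distrib)
  moreover have "CR / real B * vinner d e (\<lambda>i. f i - h i) = CR / real B * (vinner d e f - vinner d e h)"
    by (simp add: vinner_commute[of d e] vinner_diff_left)
  moreover have "CR / real B * (deviation B h D f - vinner d e (\<lambda>i. f i - h i)) \<le> CR / real B * (r * \<kappa> + r * T)"
  proof (intro mult_left_mono)
    have "vnorm d e * vnorm d (\<lambda>i. f i - h i) \<le> T * r"
      by (intro mult_mono e f order_trans[OF vnorm_nonneg e] vnorm_nonneg)
    then show "deviation B h D f - vinner d e (\<lambda>i. f i - h i) \<le> r * \<kappa> + r * T"
      using dev vinner_le[of d e "\<lambda>i. f i - h i"] by (simp add: mult.commute)
  qed (use CR in auto)
  ultimately show ?thesis
    unfolding population_objective_def noisy_objective_eq c_def[symmetric] by (simp add: algebra_simps)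
qed

text \<open>By convexity a minimizer outside the ball would produce a point of the bounding sphere on which
  the noisy objective does not exceed its value at \<open>h\<close>, against the strong convexity of the
  population objective; a uniform deviation bound on a single ball thus suffices.\<close>

lemma localization:
  assumes h: "\<And>g. population_objective h \<le> population_objective g"
    and r: "0 < r" "r * \<rho> = 5 * (CR / real B * (\<kappa> + T))"
    and e: "vnorm d e \<le> T"
    and dev: "\<And>f. vnorm d (\<lambda>i. f i - h i) \<le> r \<Longrightarrow> deviation B h D f \<le> r * \<kappa>"
  shows "population_objective (fstar CR L \<rho> d B D e) \<le> population_objective h + r\<^sup>2 * \<rho> / 5"
proof -
  let ?f = "fstar CR L \<rho> d B D e"
  let ?G = "noisy_objective D e"
  have c: "CR / real B * (\<kappa> + T) = r * \<rho> / 5" using r(2) by linarith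
  have gap: "population_objective f - population_objective h \<le> ?G f - ?G h + r\<^sup>2 * \<rho> / 5"
    if "vnorm d (\<lambda>i. f i - h i) \<le> r" for f
    using objective_gap_transfer[OF that e dev[OF that]] unfolding c
    by (simp add: power2_eq_square mult.assoc)
  have "vnorm d (\<lambda>i. ?f i - h i) \<le> r"
  proof (rule ccontr)
    assume "\<not> ?thesis"
    then have n: "r < vnorm d (\<lambda>i. ?f i - h i)" by simp
    define t where "t = r / vnorm d (\<lambda>i. ?f i - h i)"
    have t: "0 < t" "t \<le> 1" using n r by (auto simp: t_def)
    define g where "g = (\<lambda>i. t * ?f i + (1 - t) * h i)"
    have gh: "(\<lambda>i. g i - h i) = (\<lambda>i. t * (?f i - h i))" by (auto simp: g_def algebra_simps)
    have g: "vnorm d (\<lambda>i. g i - h i) = r" unfolding gh vnorm_scale using n r by (simp add: t_def)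
    have "?G g \<le> t * ?G ?f + (1 - t) * ?G h - \<rho> / 2 * t * (1 - t) * (vnorm d (\<lambda>i. ?f i - h i))\<^sup>2"
      using strongly_convex_noisy_objective[of D e] t unfolding strongly_convex_def g_def by auto
    also have "\<dots> \<le> t * ?G h + (1 - t) * ?G h - 0"
      using t \<rho> by (intro diff_mono add_mono mult_left_mono fstar_minimizes) auto
    also have "\<dots> = ?G h" by (simp add: algebra_simps)
    finally have "population_objective g - population_objective h \<le> r\<^sup>2 * \<rho> / 5" using gap[of g] g by simp
    \<comment> \<open>Growth demands \<open>\<rho> / 4 * r\<^sup>2\<close>, while the gap allows
      only \<open>r\<^sup>2 * \<rho> / 5\<close>; the factor 5 in the choice of the radius makes the
      two incompatible.\<close>
    moreover have "\<rho> / 4 * r\<^sup>2 \<le> population_objective g - population_objective h"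
      using strongly_convex_min_growth[OF strongly_convex_population_objective h, of g] by (simp add: g)
    moreover have "0 < \<rho> * r\<^sup>2" using r \<rho> by simp
    ultimately show False by (simp add: mult.commute)
  qed
  from gap[OF this] fstar_minimizes[of D e h] show ?thesis by linarith
qed

text \<open>Needed so that the success event can be bounded below by an event it contains. For fixed
  \<open>f\<close> the objective is measurable jointly in data and noise, and \<open>fstar\<close>
  enters only as its minimizer.\<close>

lemma fstar_risk_measurable:
  assumes N: "sets N = sets (lebd d)"
  shows "{\<omega> \<in> space (PiM {..<B} (\<lambda>_. P) \<Otimes>\<^sub>M N).
      risk (fstar CR L \<rho> d B (fst \<omega>) (snd \<omega>)) \<le> c} \<in> sets (PiM {..<B} (\<lambda>_. P) \<Otimes>\<^sub>M N)"
proof (rule minimizer_sublevel_measurable[where G = "\<lambda>\<omega>. noisy_objective (fst \<omega>) (snd \<omega>)"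
      and C = risk and m = "\<lambda>\<omega>. fstar CR L \<rho> d B (fst \<omega>) (snd \<omega>)" and d = d and \<rho> = \<rho>])
  fix f
  note [measurable_cong] = N
  have [measurable]: "i < d \<Longrightarrow> (\<lambda>e. e i) \<in> borel_measurable N" for i by measurable
  show "(\<lambda>\<omega>. noisy_objective (fst \<omega>) (snd \<omega>) f) \<in> borel_measurable (PiM {..<B} (\<lambda>_. P) \<Otimes>\<^sub>M N)"
    unfolding noisy_objective_eq vinner_def by measurable
qed (auto intro: strongly_convex_noisy_objective \<rho> coord_continuous_noisy_objective
      fstar_minimizes coord_continuous_risk)

text \<open>Two independent good events have probability at least \<open>1 - \<delta>\<close> each:
  small deviations on the ball around the population minimizer, and noise of norm at most
  \<open>T\<close>. Localization applies on their product.\<close>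

lemma fstar_risk_probability:
  assumes d: "0 < d" and a: "0 < a" and \<delta>: "0 < \<delta>" "\<delta> < 1/2"
    and T: "0 \<le> T" "8 * real d * ln (real d / \<delta>) / a \<le> T"
    and acc: "10 * (CR * (5 * sqrt (ln (1 / \<delta>) / real B) + T / real B))\<^sup>2 \<le> acc * \<rho>"
    and f0: "\<rho> * (vnorm d f0)\<^sup>2 \<le> acc"
  defines "Q \<equiv> PiM {..<B} (\<lambda>_. P) \<Otimes>\<^sub>M noise d a"
  shows "1 - 2 * \<delta> \<le> measure Q {\<omega> \<in> space Q.
      CR * risk (fstar CR L \<rho> d B (fst \<omega>) (snd \<omega>)) \<le> CR * risk f0 + acc}"
proof -
  let ?PB = "PiM {..<B} (\<lambda>_. P)"
  interpret PB: prob_space ?PB by (intro prob_space_PiM prob_space_axioms)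
  interpret N: prob_space "noise d a" using a d by (rule prob_space_noise)
  interpret QQ: pair_prob_space ?PB "noise d a" by standard
  obtain h where h: "\<And>g. population_objective h \<le> population_objective g"
    using population_minimizer_exists by blast
  have ln: "0 < ln (1 / \<delta>)" using \<delta> by (intro ln_gt_zero) auto
  \<comment> \<open>The error per unit of radius, from sampling and from noise; \<open>r\<close> is
    then the radius that localization asks for.\<close>
  define \<gamma> where "\<gamma> = CR * (5 * sqrt (ln (1 / \<delta>) / real B) + T / real B)"
  define r where "r = 5 * \<gamma> / \<rho>"
  define \<kappa> where "\<kappa> = 5 * sqrt (real B * ln (1 / \<delta>))"
  have "sqrt (real B * ln (1 / \<delta>)) = real B * sqrt (ln (1 / \<delta>) / real B)"
    using B real_sqrt_mult[of "(real B)\<^sup>2" "ln (1 / \<delta>) / real B"]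
    by (simp add: power2_eq_square field_simps)
  then have \<gamma>: "\<gamma> = CR / real B * (\<kappa> + T)"
    unfolding \<gamma>_def \<kappa>_def using B by (simp add: field_simps)
  have "0 < \<gamma>"
    unfolding \<gamma>_def using CR ln B T by (intro mult_pos_pos add_pos_nonneg) auto
  then have r: "0 < r" "r * \<rho> = 5 * (CR / real B * (\<kappa> + T))"
    using \<rho> unfolding \<gamma>[symmetric] by (simp_all add: r_def)
  \<comment> \<open>The left side equals \<open>5 * \<gamma>\<^sup>2 / \<rho>\<close>, so the factor
    10 in the hypothesis leaves half of \<open>acc\<close> for the regularizer at
    \<open>f0\<close>.\<close>
  have rr: "r\<^sup>2 * \<rho> / 5 \<le> acc / 2"
    using acc \<rho> unfolding \<gamma>_def[symmetric] by (simp add: r_def power2_eq_square field_simps)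
  obtain E where E: "E \<in> sets ?PB" "1 - \<delta> \<le> measure ?PB E"
    and dev: "\<And>D f. D \<in> E \<Longrightarrow> vnorm d (\<lambda>i. f i - h i) \<le> r \<Longrightarrow>
        deviation B h D f \<le> 5 * r * sqrt (real B * ln (1 / \<delta>))"
    by (rule uniform_deviation[OF r(1) B \<delta>, of h]) blast
  have \<kappa>: "5 * r * sqrt (real B * ln (1 / \<delta>)) = r * \<kappa>" by (simp add: \<kappa>_def)
  define V where "V = {e \<in> space (noise d a). vnorm d e \<le> T}"
  have V [measurable]: "V \<in> sets (noise d a)" unfolding V_def by measurable
  have "measure (noise d a) V = 1 - measure (noise d a) (space (noise d a) - V)"
    by (simp add: N.prob_compl)
  also have "space (noise d a) - V = {e \<in> space (noise d a). T < vnorm d e}"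
    by (auto simp: V_def)
  finally have V1: "1 - \<delta> \<le> measure (noise d a) V"
    using noise_tail[OF a d \<delta> T(2)] by linarith
  let ?S = "{\<omega> \<in> space Q. CR * risk (fstar CR L \<rho> d B (fst \<omega>) (snd \<omega>)) \<le> CR * risk f0 + acc}"
  have "?S = {\<omega> \<in> space Q. risk (fstar CR L \<rho> d B (fst \<omega>) (snd \<omega>)) \<le> (CR * risk f0 + acc) / CR}"
    using CR by (simp add: pos_le_divide_eq mult.commute)
  then have S: "?S \<in> sets Q"
    unfolding Q_def using fstar_risk_measurable[OF sets_noise] by simp
  have sub: "E \<times> V \<subseteq> ?S"
  proof
    fix \<omega> assume w: "\<omega> \<in> E \<times> V"
    have "\<omega> \<in> space Q"
      using w sets.sets_into_space[OF E(1)] by (auto simp: Q_def space_pair_measure V_def)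
    moreover have "CR * risk (fstar CR L \<rho> d B (fst \<omega>) (snd \<omega>)) \<le> CR * risk f0 + acc"
    proof -
      let ?f = "fstar CR L \<rho> d B (fst \<omega>) (snd \<omega>)"
      have "population_objective ?f \<le> population_objective h + r\<^sup>2 * \<rho> / 5"
        using w by (intro localization[OF h r] dev[unfolded \<kappa>]) (auto simp: V_def)
      also have "\<dots> \<le> population_objective f0 + acc / 2" using h[of f0] rr by linarith
      also have "\<dots> \<le> CR * risk f0 + acc" using f0 by (simp add: population_objective_def)
      finally show ?thesis
        using \<rho> by (auto simp: population_objective_def intro: order_trans[rotated])
    qed
    ultimately show "\<omega> \<in> ?S" by simp
  qed
  have "1 - 2 * \<delta> \<le> (1 - \<delta>) * (1 - \<delta>)" by (simp add: algebra_simps)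
  also have "\<dots> \<le> measure ?PB E * measure (noise d a) V"
    using E(2) V1 \<delta> by (intro mult_mono) auto
  also have "\<dots> = measure Q (E \<times> V)"
    unfolding Q_def using E(1) V by (simp add: measure_def N.emeasure_pair_measure_Times enn2real_mult)
  also have "\<dots> \<le> measure Q ?S"
    unfolding Q_def by (intro QQ.P.finite_measure_mono sub[unfolded Q_def] S[unfolded Q_def])
  finally show ?thesis .
qed

end

section \<open>From the sample size to the constants\<close>

lemma abs_diff_le_of_deriv_bound:
  fixes L L1 :: "real \<Rightarrow> real"
  assumes "\<And>t. (L has_real_derivative L1 t) (at t)" "\<And>t. \<bar>L1 t\<bar> \<le> 1"
  shows "\<bar>L a - L b\<bar> \<le> \<bar>a - b\<bar>"
  using field_differentiable_bound[of UNIV L L1 1 a b] assms by (auto simp: has_field_derivative_at_within)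

lemma strictly_convexD_le:
  assumes "strictly_convex L" "0 \<le> t" "t \<le> 1"
  shows "L (t * a + (1 - t) * b) \<le> t * L a + (1 - t) * L b"
proof (cases "a = b \<or> t = 0 \<or> t = 1")
  case True
  then show ?thesis by (auto simp: algebra_simps)
next
  case False
  then show ?thesis using assms unfolding strictly_convex_def by (simp add: less_imp_le)
qed

text \<open>With \<open>ln (1 + x) \<le> x\<close> it suffices that
  \<open>x \<le> \<alpha> / 4\<close>. The summand with \<open>\<eta>\<close> only enlarges the
  denominator, so the bound on \<open>real B * \<rho> * \<alpha>\<close> gives this.\<close>

lemma alpha_hat_ge_half:
  assumes CR: "CR > 0" and \<eta>: "\<eta> > 0" and c1: "0 \<le> c1" and \<rho>: "0 < \<rho>" and B: "0 < B"
    and BB: "4 * (CR * c1) \<le> real B * \<rho> * \<alpha>"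
  shows "\<alpha> / 2 \<le> alpha_hat \<alpha> c1 CR B \<rho> \<eta> Np"
proof -
  let ?x = "c1 * CR / (real B * (\<rho> + 2 * \<eta> * real Np))"
  have "?x \<le> c1 * CR / (real B * \<rho>)"
    using assms by (intro divide_left_mono mult_left_mono mult_pos_pos add_pos_nonneg) auto
  also have "\<dots> \<le> \<alpha> / 4" using BB \<rho> B by (simp add: field_simps)
  finally have "?x \<le> \<alpha> / 4" .
  moreover have "0 \<le> ?x" using assms by (intro divide_nonneg_nonneg mult_nonneg_nonneg add_nonneg_nonneg) auto
  then have "ln (1 + ?x) \<le> ?x" by (rule ln_add_one_self_le_self)
  ultimately show ?thesis unfolding alpha_hat_def by linarith
qed

text \<open>\<open>D\<close> stands for \<open>d * ln (d / \<delta>)\<close> and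
  \<open>16 * D / \<alpha>\<close> for the noise radius. Sampling and noise each contribute at most
  \<open>acc / (8 * n)\<close>, and 10 times the square of \<open>acc / (4 * n)\<close> stays below
  \<open>acc\<^sup>2 / n\<^sup>2\<close>.\<close>

lemma accuracy_from_sample_size:
  fixes CR n acc \<alpha> l D :: real
  assumes CR: "0 < CR" and n: "0 < n" and acc: "0 < acc" and \<alpha>: "0 < \<alpha>" and l: "0 < l" and B: "0 < B"
    and B1: "1600 * CR * (n * D / (acc * \<alpha>)) \<le> B"
    and B3: "1600 * CR * (CR * n\<^sup>2 * l / acc\<^sup>2) \<le> B"
    and D: "0 \<le> D"
  shows "10 * (CR * (5 * sqrt (l / B) + (16 * D / \<alpha>) / B))\<^sup>2 \<le> acc * (acc / n\<^sup>2)"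
proof -
  have "5 * (CR * sqrt (l / B)) \<le> acc / (8 * n)"
  proof (rule power2_le_imp_le)
    \<comment> \<open>The constant 1600 is the square of \<open>5 * 8\<close>; the noise term below
      would need only \<open>16 * 8\<close>.\<close>
    have "1600 * (CR\<^sup>2 * n\<^sup>2 * l) \<le> B * acc\<^sup>2"
      using B3 acc by (simp add: field_simps power2_eq_square)
    then have "25 * (CR\<^sup>2 * (l / B)) \<le> acc\<^sup>2 / (64 * n\<^sup>2)"
      using B n by (simp add: field_simps)
    then show "(5 * (CR * sqrt (l / B)))\<^sup>2 \<le> (acc / (8 * n))\<^sup>2"
      using l B by (simp add: power_mult_distrib power_divide)
  qed (use acc n in simp)
  moreover have "CR * ((16 * D / \<alpha>) / B) \<le> acc / (8 * n)"
  proof -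
    have "128 * (CR * n * D) \<le> 1600 * (CR * n * D)" using CR n D by simp
    also have "\<dots> \<le> B * (acc * \<alpha>)"
      using B1 acc \<alpha> by (simp add: field_simps)
    finally show ?thesis using B n \<alpha> by (simp add: field_simps)
  qed
  ultimately have "CR * (5 * sqrt (l / B) + (16 * D / \<alpha>) / B) \<le> acc / (4 * n)"
    by (simp add: distrib_left)
  moreover have "0 \<le> CR * (5 * sqrt (l / B) + (16 * D / \<alpha>) / B)"
    using CR l B D \<alpha> by (intro mult_nonneg_nonneg add_nonneg_nonneg) auto
  ultimately have "(CR * (5 * sqrt (l / B) + (16 * D / \<alpha>) / B))\<^sup>2 \<le> (acc / (4 * n))\<^sup>2"
    by (rule power_mono)
  then have "10 * (CR * (5 * sqrt (l / B) + (16 * D / \<alpha>) / B))\<^sup>2 \<le> 10 * (acc / (4 * n))\<^sup>2" by simp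
  also have "\<dots> \<le> acc * (acc / n\<^sup>2)"
    using acc n by (simp add: power2_eq_square field_simps)
  finally show ?thesis .
qed

theorem theorem4:
  fixes CR c1 \<eta> :: real and Np :: nat
  assumes "CR > 0" and "\<eta> > 0" and "Np \<ge> 1"
  shows "\<exists>\<beta>>0. \<forall>(L :: real \<Rightarrow> real) L1 L2 d (P :: ((nat \<Rightarrow> real) \<times> real) measure)
            f0 \<alpha>acc \<alpha> \<delta> (B :: nat).
     strictly_convex L \<and>
     (\<forall>t. (L has_real_derivative L1 t) (at t)) \<and>
     (\<forall>t. (L1 has_real_derivative L2 t) (at t)) \<and> continuous_on UNIV L2 \<and>
     (\<forall>t. \<bar>L1 t\<bar> \<le> 1 \<and> \<bar>L2 t\<bar> \<le> c1) \<and>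
     prob_space P \<and> sets P = sets (lebd d \<Otimes>\<^sub>M lborel) \<and>
     (AE z in P. vnorm d (fst z) \<le> 1 \<and> (snd z = 1 \<or> snd z = -1)) \<and>
     f0 \<in> Rd d \<and> vnorm d f0 \<noteq> 0 \<and>
     0 < \<alpha>acc \<and> \<alpha>acc \<le> 1 \<and> 0 < \<alpha> \<and> \<alpha> \<le> 1 \<and> 0 < \<delta> \<and> \<delta> < 1/2 \<and>
     real B > \<beta> * max (max
         (vnorm d f0 * real d * ln (real d / \<delta>) / (\<alpha>acc * \<alpha>))
         (CR * c1 * (vnorm d f0)\<^sup>2 / (\<alpha>acc * \<alpha>)))
         (CR * (vnorm d f0)\<^sup>2 * ln (1 / \<delta>) / \<alpha>acc\<^sup>2)
     \<longrightarrow>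
     (let \<rho> = \<alpha>acc / (vnorm d f0)\<^sup>2;
          \<alpha>h = alpha_hat \<alpha> c1 CR B \<rho> \<eta> Np;
          Q = PiM {..<B} (\<lambda>_. P) \<Otimes>\<^sub>M noise d \<alpha>h
      in \<alpha>h > 0 \<and>
         measure Q {\<omega> \<in> space Q.
             Chat CR L P d (fstar CR L \<rho> d B (fst \<omega>) (snd \<omega>)) \<le> Chat CR L P d f0 + \<alpha>acc}
           \<ge> 1 - 2 * \<delta>)"
proof (intro exI[of _ "4 + 1600 * CR"] conjI allI impI)
  \<comment> \<open>In this witness the summand 4 serves the lower bound on
    \<open>\<alpha>h\<close>, and \<open>1600 * CR\<close> serves the accuracy.\<close>
  show "0 < 4 + 1600 * CR" using assms(1) by simp
next
  fix L L1 L2 :: "real \<Rightarrow> real" and d :: nat and P :: "((nat \<Rightarrow> real) \<times> real) measure"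
    and f0 :: "nat \<Rightarrow> real" and \<alpha>acc \<alpha> \<delta> :: real and B :: nat
  let ?n = "vnorm d f0"
  let ?m1 = "?n * real d * ln (real d / \<delta>) / (\<alpha>acc * \<alpha>)"
  let ?m2 = "CR * c1 * ?n\<^sup>2 / (\<alpha>acc * \<alpha>)"
  let ?m3 = "CR * ?n\<^sup>2 * ln (1 / \<delta>) / \<alpha>acc\<^sup>2"
  let ?D = "real d * ln (real d / \<delta>)"
  assume "strictly_convex L \<and>
     (\<forall>t. (L has_real_derivative L1 t) (at t)) \<and>
     (\<forall>t. (L1 has_real_derivative L2 t) (at t)) \<and> continuous_on UNIV L2 \<and>
     (\<forall>t. \<bar>L1 t\<bar> \<le> 1 \<and> \<bar>L2 t\<bar> \<le> c1) \<and>
     prob_space P \<and> sets P = sets (lebd d \<Otimes>\<^sub>M lborel) \<and>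
     (AE z in P. vnorm d (fst z) \<le> 1 \<and> (snd z = 1 \<or> snd z = -1)) \<and>
     f0 \<in> Rd d \<and> vnorm d f0 \<noteq> 0 \<and>
     0 < \<alpha>acc \<and> \<alpha>acc \<le> 1 \<and> 0 < \<alpha> \<and> \<alpha> \<le> 1 \<and> 0 < \<delta> \<and> \<delta> < 1/2 \<and>
     real B > (4 + 1600 * CR) * max (max ?m1 ?m2) ?m3"
  then have L: "strictly_convex L" "\<And>t. (L has_real_derivative L1 t) (at t)" "\<And>t. \<bar>L1 t\<bar> \<le> 1" "\<bar>L2 0\<bar> \<le> c1"
    and P: "prob_space P" "sets P = sets (lebd d \<Otimes>\<^sub>M lborel)"
      "AE z in P. vnorm d (fst z) \<le> 1 \<and> (snd z = 1 \<or> snd z = -1)"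
    and f0: "?n \<noteq> 0" and acc: "0 < \<alpha>acc" and \<alpha>: "0 < \<alpha>" and \<delta>: "0 < \<delta>" "\<delta> < 1/2"
    and max_less: "(4 + 1600 * CR) * max (max ?m1 ?m2) ?m3 < real B" by auto
  have c1: "0 \<le> c1" using L(4) by linarith
  have n: "0 < ?n" using f0 vnorm_nonneg[of d f0] by linarith
  have d: "0 < d" using f0 by (cases d) (auto simp: vnorm_def)
  have ln: "0 < ln (1 / \<delta>)" using \<delta> by (intro ln_gt_zero) auto
  have D: "0 \<le> ?D" using d \<delta> by (intro mult_nonneg_nonneg ln_ge_zero) (auto simp: le_divide_eq)
  have m0: "0 \<le> ?m1" "0 \<le> ?m2" "0 \<le> ?m3"
    using D n c1 assms(1) acc \<alpha> ln by (auto simp: mult.assoc intro!: mult_nonneg_nonneg divide_nonneg_nonneg)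
  \<comment> \<open>The three maximands are nonnegative, so each of them may be used alone and with
    any smaller nonnegative factor; factor 0 yields that \<open>B\<close> is positive.\<close>
  have less: "\<beta> * m < real B"
    if "0 \<le> \<beta>" "\<beta> \<le> 4 + 1600 * CR" "m \<le> max (max ?m1 ?m2) ?m3" for \<beta> m
  proof -
    have "\<beta> * m \<le> \<beta> * max (max ?m1 ?m2) ?m3" using that by (intro mult_left_mono) auto
    also have "\<dots> \<le> (4 + 1600 * CR) * max (max ?m1 ?m2) ?m3" using that m0 by (intro mult_right_mono) auto
    finally show ?thesis using max_less by linarith
  qed
  have le: "?m1 \<le> max (max ?m1 ?m2) ?m3" "?m2 \<le> max (max ?m1 ?m2) ?m3" "?m3 \<le> max (max ?m1 ?m2) ?m3"
    by (simp_all only: le_max_iff_disj order_refl simp_thms)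
  have B: "0 < B" using less[OF _ _ le(3), of 0] assms(1) by simp
  define \<rho> where "\<rho> = \<alpha>acc / ?n\<^sup>2"
  define \<alpha>h where "\<alpha>h = alpha_hat \<alpha> c1 CR B \<rho> \<eta> Np"
  have \<rho>: "0 < \<rho>" using acc n by (simp add: \<rho>_def)
  have "4 * (CR * c1) \<le> real B * \<rho> * \<alpha>"
    using less[OF _ _ le(2), of 4] assms(1) acc \<alpha> n by (simp add: \<rho>_def field_simps)
  then have half: "\<alpha> / 2 \<le> \<alpha>h"
    unfolding \<alpha>h_def using assms c1 \<rho> B by (intro alpha_hat_ge_half)
  then have \<alpha>h: "0 < \<alpha>h" using \<alpha> by linarith
  interpret margin_loss P L d
    using P abs_diff_le_of_deriv_bound[OF L(2,3)] by (auto simp: margin_loss_def margin_loss_axioms_def)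
  interpret convex_margin_loss P L d CR \<rho> B
    using strictly_convexD_le[OF L(1)] assms(1) \<rho> B by unfold_locales
  \<comment> \<open>Since \<open>\<alpha>h\<close> is at least \<open>\<alpha> / 2\<close>, the
    noise threshold is at most \<open>16 * ?D / \<alpha>\<close>, the radius used in the accuracy
    estimate.\<close>
  have "8 * real d * ln (real d / \<delta>) / \<alpha>h \<le> 8 * real d * ln (real d / \<delta>) / (\<alpha> / 2)"
    using half \<alpha> D by (intro divide_left_mono) (auto simp: mult.assoc)
  then have T: "8 * real d * ln (real d / \<delta>) / \<alpha>h \<le> 16 * ?D / \<alpha>" by (simp add: mult.assoc)
  have "10 * (CR * (5 * sqrt (ln (1 / \<delta>) / real B) + 16 * ?D / \<alpha> / real B))\<^sup>2 \<le> \<alpha>acc * (\<alpha>acc / ?n\<^sup>2)"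
    using less[OF _ _ le(1), of "1600 * CR"] less[OF _ _ le(3), of "1600 * CR"] assms(1) n acc \<alpha> ln B D
    by (intro accuracy_from_sample_size) (auto simp: mult.assoc)
  then have "1 - 2 * \<delta> \<le> measure (PiM {..<B} (\<lambda>_. P) \<Otimes>\<^sub>M noise d \<alpha>h)
     {\<omega> \<in> space (PiM {..<B} (\<lambda>_. P) \<Otimes>\<^sub>M noise d \<alpha>h).
        CR * risk (fstar CR L \<rho> d B (fst \<omega>) (snd \<omega>)) \<le> CR * risk f0 + \<alpha>acc}"
    using D \<alpha> n by (intro fstar_risk_probability[OF d \<alpha>h \<delta> _ T]) (auto simp: \<rho>_def)
  moreover have "Chat CR L P d f = CR * risk f" for f
    by (simp add: Chat_def risk_def margin_def)
  ultimately show "let \<rho> = \<alpha>acc / ?n\<^sup>2;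
          \<alpha>h = alpha_hat \<alpha> c1 CR B \<rho> \<eta> Np;
          Q = PiM {..<B} (\<lambda>_. P) \<Otimes>\<^sub>M noise d \<alpha>h
      in \<alpha>h > 0 \<and>
         measure Q {\<omega> \<in> space Q.
             Chat CR L P d (fstar CR L \<rho> d B (fst \<omega>) (snd \<omega>)) \<le> Chat CR L P d f0 + \<alpha>acc}
           \<ge> 1 - 2 * \<delta>"
    using \<alpha>h by (simp add: Let_def flip: \<rho>_def \<alpha>h_def)
qed

end
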